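(* Let $\mathcal{G}$ be a hereditary class of graphs. If $\mathcal{G}$ is degree-bounded, then the antidirected extension $\vec{\mathcal{G}}$ of $\mathcal{G}$ is degree-bounded.
   Context: Graphs are finite and simple. A class of graphs is hereditary if it is closed under taking induced subgraphs (and isomorphism). The biclique number $\tau(G)$ is the largest integer $s$ such that $G$ contains a copy of $K_{s,s}$ as a (not necessarily induced) subgraph. The degeneracy $\delta^\star(G)$ is the least integer $d$ such that every nonempty subgraph of $G$ contains a vertex of degree at most $d$. A class $\mathcal{G}$ is degree-bounded if there exists a function $g\colon\mathbb{N}\to\mathbb{N}$ such that every $H\in\mathcal{G}$ satisfies $\delta^\star(H)\leq g(\tau(H))$. An oriented graph is a digraph with at most one arc between any pair of vertices; an orientation of a graph $G$ is an oriented graph whose underlying graph is $G$. An oriented graph is antidirected if each of its vertices is a source or a sink. A graph $G$ is $\mathcal{G}$-orientable if there exists an orientation $D$ of $G$ such that, for every induced antidirected subdigraph $H$ of $D$, the underlying graph of $H$ belongs to $\mathcal{G}$. The antidirected extension $\vec{\mathcal{G}}$ is the class of all $\mathcal{G}$-orientable graphs. *)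

theory Defs
  imports "Graph_Theory.Graph_Theory"
begin

text \<open>
  A finite simple graph is a \<^const>\<open>pair_graph\<close>: each edge is stored as a pair of opposite arcs.
  In such a graph \<^const>\<open>out_degree\<close> counts neighbours, so it is the usual degree.
\<close>

definition graph_class :: "'a pair_pre_digraph set \<Rightarrow> bool" where
  "graph_class \<G> \<longleftrightarrow> (\<forall>G\<in>\<G>. pair_graph G)"

definition hereditary :: "'a pair_pre_digraph set \<Rightarrow> bool" where
  "hereditary \<G> \<longleftrightarrow>
    (\<forall>G\<in>\<G>. \<forall>H. induced_subgraph (with_proj H) (with_proj G) \<longrightarrow> H \<in> \<G>) \<and>
    (\<forall>G\<in>\<G>. \<forall>H. digraph_iso (with_proj G) (with_proj H) \<longrightarrow> H \<in> \<G>)"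

definition contains_biclique :: "nat \<Rightarrow> 'a pair_pre_digraph \<Rightarrow> bool" where
  "contains_biclique s G \<longleftrightarrow>
    (\<exists>H. subgraph (with_proj H) (with_proj G) \<and> K\<^bsub>s,s\<^esub> (with_proj H))"

definition biclique_number :: "'a pair_pre_digraph \<Rightarrow> nat" where
  "biclique_number G = Max {s. contains_biclique s G}"

definition degeneracy :: "'a pair_pre_digraph \<Rightarrow> nat" where
  "degeneracy G = (LEAST d. \<forall>H. pair_graph H \<and> subgraph (with_proj H) (with_proj G) \<and> pverts H \<noteq> {} \<longrightarrow>
      (\<exists>v\<in>pverts H. out_degree (with_proj H) v \<le> d))"

definition degree_bounded :: "'a pair_pre_digraph set \<Rightarrow> bool" where
  "degree_bounded \<G> \<longleftrightarrow>
    (\<exists>g :: nat \<Rightarrow> nat. \<forall>H\<in>\<G>. degeneracy H \<le> g (biclique_number H))"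

definition oriented_graph :: "'a pair_pre_digraph \<Rightarrow> bool" where
  "oriented_graph D \<longleftrightarrow> pair_digraph D \<and> (\<forall>u v. (u, v) \<in> parcs D \<longrightarrow> (v, u) \<notin> parcs D)"

abbreviation underlying_graph :: "'a pair_pre_digraph \<Rightarrow> 'a pair_pre_digraph" where
  "underlying_graph D \<equiv> mk_symmetric (with_proj D)"

definition orientation_of :: "'a pair_pre_digraph \<Rightarrow> 'a pair_pre_digraph \<Rightarrow> bool" where
  "orientation_of D G \<longleftrightarrow> oriented_graph D \<and> underlying_graph D = G"

definition source :: "'a pair_pre_digraph \<Rightarrow> 'a \<Rightarrow> bool" where
  "source D v \<longleftrightarrow> in_arcs (with_proj D) v = {}"

definition sink :: "'a pair_pre_digraph \<Rightarrow> 'a \<Rightarrow> bool" where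
  "sink D v \<longleftrightarrow> out_arcs (with_proj D) v = {}"

definition antidirected :: "'a pair_pre_digraph \<Rightarrow> bool" where
  "antidirected D \<longleftrightarrow> oriented_graph D \<and> (\<forall>v\<in>pverts D. source D v \<or> sink D v)"

definition orientable :: "'a pair_pre_digraph set \<Rightarrow> 'a pair_pre_digraph \<Rightarrow> bool" where
  "orientable \<G> G \<longleftrightarrow>
    (\<exists>D. orientation_of D G \<and>
      (\<forall>H. induced_subgraph (with_proj H) (with_proj D) \<and> antidirected H \<longrightarrow> underlying_graph H \<in> \<G>))"

definition antidirected_extension :: "'a pair_pre_digraph set \<Rightarrow> 'a pair_pre_digraph set" where
  "antidirected_extension \<G> = {G. pair_graph G \<and> orientable \<G> G}"

text \<open>The maximum and the minimum in \<^const>\<open>biclique_number\<close> and \<^const>\<open>degeneracy\<close> exist.\<close>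

lemma finite_bicliques:
  assumes "pair_graph G"
  shows "finite {s. contains_biclique s G}"
proof (rule finite_subset)
  interpret pair_graph G by fact
  show "{s. contains_biclique s G} \<subseteq> {..card (pverts G)}"
  proof
    fix s assume "s \<in> {s. contains_biclique s G}"
    then obtain U where "U \<subseteq> pverts G" "card U = s"
      by (auto simp: contains_biclique_def subgraph_def complete_bipartite_digraph_def)
    then show "s \<in> {..card (pverts G)}"
      using \<open>card U = s\<close> card_mono[OF pair_finite_verts] by auto
  qed
qed simp

lemma contains_biclique_0:
  assumes "pair_graph G"
  shows "contains_biclique 0 G"
proof -
  interpret pair_graph G by fact
  let ?H = "\<lparr>pverts = {}, parcs = {}\<rparr> :: 'a pair_pre_digraph"
  have "pair_wf_digraph ?H" by unfold_locales auto
  then have "subgraph (with_proj ?H) (with_proj G)"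
    using pair_wf_digraph by (auto simp: subgraph_def wf_digraph_wp_iff)
  moreover have "K\<^bsub>0,0\<^esub> (with_proj ?H)"
    by (auto simp: complete_bipartite_digraph_pair_def)
  ultimately show ?thesis unfolding contains_biclique_def by blast
qed

lemma degeneracy_exists:
  assumes "pair_graph G"
  shows "\<exists>d. \<forall>H. pair_graph H \<and> subgraph (with_proj H) (with_proj G) \<and> pverts H \<noteq> {} \<longrightarrow>
      (\<exists>v\<in>pverts H. out_degree (with_proj H) v \<le> d)"
proof (intro exI allI impI)
  interpret pair_graph G by fact
  fix H assume H: "pair_graph H \<and> subgraph (with_proj H) (with_proj G) \<and> pverts H \<noteq> {}"
  then obtain v where "v \<in> pverts H" by auto
  moreover have "out_arcs (with_proj H) v \<subseteq> parcs G"
    using H by (auto simp: subgraph_def)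
  then have "out_degree (with_proj H) v \<le> card (parcs G)"
    unfolding out_degree_def by (rule card_mono[OF pair_finite_arcs])
  ultimately show "\<exists>v\<in>pverts H. out_degree (with_proj H) v \<le> card (parcs G)" by blast
qed

end

theory Submission
  imports Defs "HOL-Library.Ramsey"
begin

text \<open>
  Let \<open>G\<close> have degeneracy \<open>d\<close> and no \<open>K\<^sub>s\<^sub>,\<^sub>s\<close> and pass to a subgraph on \<open>n\<close> vertices with minimum degree
  \<open>d\<close>. Half of its vertices have degree at most \<open>4d\<close>, and half of these have at least \<open>d/2\<close> neighbours in
  one fixed direction; call this set \<open>Q\<close>. Sample every vertex with probability \<open>1/d\<close> and let \<open>R\<close> be the sampled
  vertices without a sampled forward neighbour in a degeneracy order, so that \<open>R\<close> is stable. By Ramsey's theorem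
  a positive fraction of the \<open>k\<close>-subsets of a neighbourhood is stable, hence each \<open>q \<in> Q\<close> has, with
  probability bounded below in terms of \<open>k\<close> and \<open>s\<close>, at least \<open>k\<close> neighbours in \<open>R\<close> in the right
  direction and none in the wrong one. As \<open>|R| \<le> n/d\<close> in expectation, it remains to find a stable set of
  these \<open>q\<close> of size \<open>\<omega>(n/d)\<close>, which exists because the induced graph has maximum degree \<open>O(d)\<close> and is
  clique-free. The resulting induced antidirected graph has average degree about \<open>k\<close>, which bounds \<open>d\<close>.
\<close>

subsection \<open>Stable sets in clique-free graphs\<close>

text \<open>A graph is carried as a relation together with a vertex set. Induced subgraphs then
  arise by shrinking the set alone, and for an arc relation \<open>D\<close> the in-neighbours are
  \<open>nbrs (D\<inverse>)\<close>.\<close>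

definition nbrs :: "'a rel \<Rightarrow> 'a set \<Rightarrow> 'a \<Rightarrow> 'a set" where
  "nbrs E S v = {u \<in> S. (v, u) \<in> E}"

definition stable_set :: "'a rel \<Rightarrow> 'a set \<Rightarrow> bool" where
  "stable_set E S \<longleftrightarrow> (\<forall>u\<in>S. \<forall>v\<in>S. (u, v) \<notin> E)"

definition stable_sets :: "'a rel \<Rightarrow> 'a set \<Rightarrow> 'a set set" where
  "stable_sets E S = {I. I \<subseteq> S \<and> stable_set E I}"

definition clique_free :: "nat \<Rightarrow> 'a rel \<Rightarrow> 'a set \<Rightarrow> bool" where
  "clique_free c E S \<longleftrightarrow> \<not> (\<exists>K\<subseteq>S. card K = c \<and> (\<forall>u\<in>K. \<forall>v\<in>K. u \<noteq> v \<longrightarrow> (u, v) \<in> E))"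

lemma clique_free_mono: "clique_free c E S \<Longrightarrow> T \<subseteq> S \<Longrightarrow> clique_free c E T"
  unfolding clique_free_def by blast

lemma finite_nbrs [simp]: "finite S \<Longrightarrow> finite (nbrs E S v)"
  by (simp add: nbrs_def)

lemma finite_stable_sets [simp]: "finite S \<Longrightarrow> finite (stable_sets E S)"
  by (simp add: stable_sets_def)

lemma empty_in_stable_sets: "{} \<in> stable_sets E S"
  by (simp add: stable_sets_def stable_set_def)

section \<open>Counting stable sets with Ramsey's theorem\<close>

lemma card_supersets_le:
  assumes "finite N" "T \<subseteq> N" "card T \<le> r"
  shows "card {S. T \<subseteq> S \<and> S \<subseteq> N \<and> card S = r} \<le> (card N - card T) choose (r - card T)"
proof -
  have fT: "finite T" using assms finite_subset by blast
  let ?B = "{A. A \<subseteq> N - T \<and> card A = r - card T}"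
  have "{S. T \<subseteq> S \<and> S \<subseteq> N \<and> card S = r} \<subseteq> (\<lambda>A. A \<union> T) ` ?B"
  proof
    fix S assume S: "S \<in> {S. T \<subseteq> S \<and> S \<subseteq> N \<and> card S = r}"
    then have "S = (S - T) \<union> T" "S - T \<in> ?B"
      using fT card_Diff_subset[OF fT, of S] by auto
    then show "S \<in> (\<lambda>A. A \<union> T) ` ?B" by blast
  qed
  then have "card {S. T \<subseteq> S \<and> S \<subseteq> N \<and> card S = r} \<le> card ((\<lambda>A. A \<union> T) ` ?B)"
    by (rule card_mono[rotated]) (use assms in auto)
  also have "\<dots> \<le> card ?B" by (rule card_image_le) (use assms in auto)
  also have "\<dots> = card (N - T) choose (r - card T)"
    by (rule n_subsets) (use assms in auto)
  also have "card (N - T) = card N - card T"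
    using assms fT by (simp add: card_Diff_subset)
  finally show ?thesis .
qed

text \<open>By Ramsey's theorem every \<open>r\<close>-subset of a clique-free set contains a stable
  \<open>t\<close>-set, while a given \<open>t\<close>-set lies in few \<open>r\<close>-sets. Double
  counting the inclusions shows that a fraction of at least \<open>1 / (r choose t)\<close> of all
  \<open>t\<close>-subsets is stable.\<close>

lemma many_stable_subsets:
  "\<exists>r\<ge>t. \<forall>(E :: 'a rel) N. sym E \<longrightarrow> irrefl E \<longrightarrow> finite N \<longrightarrow> clique_free c E N \<longrightarrow> r \<le> card N \<longrightarrow>
     card N choose t \<le> card {T \<in> stable_sets E N. card T = t} * (r choose t)"
proof -
  obtain r0 where r0: "\<forall>(V::'a set) (F::'a set set). finite V \<and> card V \<ge> r0 \<longrightarrow>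
      (\<exists>R \<subseteq> V. card R = c \<and> clique R F \<or> card R = t \<and> indep R F)"
    using ramsey2 by blast
  define r where "r = max r0 t"
  have "card N choose t \<le> card {T \<in> stable_sets E N. card T = t} * (r choose t)"
    if E: "sym E" "irrefl E" and N: "finite N" "clique_free c E N" "r \<le> card N"
    for E :: "'a rel" and N
  proof -
    let ?T = "{T \<in> stable_sets E N. card T = t}"
    have fT: "finite ?T" using N by simp
    have ex: "\<exists>T\<in>?T. T \<subseteq> S" if S: "S \<subseteq> N" "card S = r" for S
    proof -
      let ?F = "{{u, v} |u v. (u, v) \<in> E}"
      have inF: "{u, v} \<in> ?F \<longleftrightarrow> (u, v) \<in> E" for u v
        using \<open>sym E\<close> by (auto simp: doubleton_eq_iff dest: symD)
      have "finite S" using S N finite_subset by blast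
      then obtain R where R: "R \<subseteq> S" "card R = c \<and> clique R ?F \<or> card R = t \<and> indep R ?F"
        using r0[rule_format, of S ?F] S by (auto simp: r_def)
      have "\<not> (card R = c \<and> clique R ?F)"
        using N(2) R(1) S(1) unfolding clique_free_def clique_def inF by blast
      then have "card R = t" "indep R ?F" using R by auto
      then have "stable_set E R"
        unfolding stable_set_def indep_def inF using \<open>irrefl E\<close> by (metis irrefl_def)
      then show ?thesis
        using R S \<open>card R = t\<close> by (auto simp: stable_sets_def)
    qed
    have tr: "t \<le> r" by (simp add: r_def)
    have "card N choose r = card {S. S \<subseteq> N \<and> card S = r}"
      using N n_subsets by metis
    also have "\<dots> \<le> card (\<Union>T\<in>?T. {S. T \<subseteq> S \<and> S \<subseteq> N \<and> card S = r})"
      by (rule card_mono) (use ex N fT in auto)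
    also have "\<dots> \<le> (\<Sum>T\<in>?T. card {S. T \<subseteq> S \<and> S \<subseteq> N \<and> card S = r})"
      by (rule card_UN_le[OF fT])
    also have "\<dots> \<le> (\<Sum>T\<in>?T. (card N - t) choose (r - t))"
    proof (rule sum_mono)
      fix T assume "T \<in> ?T"
      then show "card {S. T \<subseteq> S \<and> S \<subseteq> N \<and> card S = r} \<le> (card N - t) choose (r - t)"
        using card_supersets_le[OF N(1), of T r] tr by (auto simp: stable_sets_def)
    qed
    finally have "card N choose r \<le> card ?T * ((card N - t) choose (r - t))" by simp
    then have "(card N choose r) * (r choose t) \<le> card ?T * ((card N - t) choose (r - t)) * (r choose t)"
      by (rule mult_right_mono) simp
    also have "(card N choose r) * (r choose t) = (card N choose t) * ((card N - t) choose (r - t))"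
      by (rule choose_mult[OF tr N(3)])
    also have "card ?T * ((card N - t) choose (r - t)) * (r choose t)
        = card ?T * (r choose t) * ((card N - t) choose (r - t))"
      by (simp only: mult_ac)
    finally have "(card N choose t) * ((card N - t) choose (r - t))
        \<le> card ?T * (r choose t) * ((card N - t) choose (r - t))" .
    moreover have "(card N - t) choose (r - t) > 0" using N(3) by simp
    ultimately show ?thesis by simp
  qed
  moreover have "r \<ge> t" by (simp add: r_def)
  ultimately show ?thesis by blast
qed

text \<open>Stable sets with fewer than \<open>t\<close> elements number O(x^(t-1)) in a set of size
  x, whereas the stable \<open>t\<close>-sets already number a positive fraction of
  \<open>x choose t\<close>. For large x the latter win.\<close>

lemma most_stable_sets_large:
  "\<exists>m. \<forall>(E :: 'a rel) X. sym E \<longrightarrow> irrefl E \<longrightarrow> finite X \<longrightarrow> clique_free c E X \<longrightarrow> m \<le> card X \<longrightarrow>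
     card (stable_sets E X) \<le> 2 * card {I \<in> stable_sets E X. t \<le> card I}"
proof (cases t)
  case 0
  then show ?thesis by simp
next
  case (Suc t')
  obtain r where "r \<ge> t" and r: "\<And>(E :: 'a rel) N. \<lbrakk>sym E; irrefl E; finite N; clique_free c E N; r \<le> card N\<rbrakk> \<Longrightarrow>
     card N choose t \<le> card {T \<in> stable_sets E N. card T = t} * (r choose t)"
    using many_stable_subsets[of t c] by blast
  define m where "m = r + 2 * t + t * t * (r choose t)"
  have "card (stable_sets E X) \<le> 2 * card {I \<in> stable_sets E X. t \<le> card I}"
    if E: "sym E" "irrefl E" and X: "finite X" "clique_free c E X" "m \<le> card X"
    for E :: "'a rel" and X
  proof -
    let ?x = "card X" and ?C = "r choose t"
    let ?S = "{I \<in> stable_sets E X. card I < t}" and ?L = "{I \<in> stable_sets E X. t \<le> card I}"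
    have "card ?S \<le> card (\<Union>j<t. {I. I \<subseteq> X \<and> card I = j})"
      by (rule card_mono) (use X in \<open>auto simp: stable_sets_def\<close>)
    also have "\<dots> \<le> (\<Sum>j<t. card {I. I \<subseteq> X \<and> card I = j})"
      by (rule card_UN_le) simp
    also have "\<dots> = (\<Sum>j<t. ?x choose j)" using X by (simp add: n_subsets)
    \<comment> \<open>The summand \<open>2 * t\<close> of \<open>m\<close> keeps \<open>t'\<close>
      in the range where binomial coefficients increase.\<close>
    also have "\<dots> \<le> (\<Sum>j<t. ?x choose t')"
      by (intro sum_mono binomial_mono) (use X Suc in \<open>auto simp: m_def\<close>)
    finally have S: "card ?S \<le> t * (?x choose t')" by simp
    \<comment> \<open>Passing from level \<open>t'\<close> to level \<open>t\<close> gains the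
      factor \<open>(?x - t') / t\<close>. The summand \<open>t * t * (r choose t)\<close> of
      \<open>m\<close> makes this gain outweigh both the number of levels and the Ramsey
      loss.\<close>
    have bin: "(?x - t') * (?x choose t') = t * (?x choose t)"
      using binomial_absorb_comp[of ?x t'] times_binomial_minus1_eq[of t ?x] Suc by simp
    have "t * t * ?C \<le> ?x - t'" using X(3) Suc unfolding m_def by linarith
    then have "t * ?C * (t * (?x choose t')) \<le> (?x - t') * (?x choose t')"
      using mult_right_mono[of "t * t * ?C" "?x - t'" "?x choose t'"] by (simp add: mult_ac)
    also have "\<dots> = t * (?x choose t)" by (rule bin)
    also have "\<dots> \<le> t * (card {T \<in> stable_sets E X. card T = t} * ?C)"
      using r[OF E X(1,2)] X(3) by (simp add: m_def)
    also have "card {T \<in> stable_sets E X. card T = t} \<le> card ?L"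
      by (rule card_mono) (use X in auto)
    finally have "t * ?C * (t * (?x choose t')) \<le> t * ?C * card ?L"
      by (simp add: mult_ac)
    moreover have "t * ?C > 0" using \<open>r \<ge> t\<close> Suc by simp
    ultimately have "t * (?x choose t') \<le> card ?L" by simp
    with S have "card ?S \<le> card ?L" by linarith
    moreover have "card (stable_sets E X) = card ?S + card ?L"
      by (subst card_Un_disjoint[symmetric]) (use X in \<open>auto intro: arg_cong[where f=card]\<close>)
    ultimately show ?thesis by linarith
  qed
  then show ?thesis by blast
qed

text \<open>
  Conditioned on its trace outside \<open>N[v]\<close>, a uniformly random stable set either is \<open>{v}\<close> on
  \<open>N[v]\<close>, or is a uniformly random stable subset of the set \<open>X\<close> of available neighbours of \<open>v\<close>.
  If \<open>X\<close> is small, \<open>v\<close> is chosen with probability bounded below; if \<open>X\<close> is large, many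
  neighbours of \<open>v\<close> are expected to be chosen.
\<close>

lemma large_stable_set:
  "\<exists>a. \<forall>(E :: 'a rel) V \<Delta>. sym E \<longrightarrow> irrefl E \<longrightarrow> finite V \<longrightarrow> clique_free c E V \<longrightarrow>
     (\<forall>v\<in>V. card (nbrs E V v) \<le> \<Delta>) \<longrightarrow> a \<le> \<Delta> \<longrightarrow>
     (\<exists>W\<in>stable_sets E V. t * card V \<le> \<Delta> * card W)"
proof -
  \<comment> \<open>The 8 is the product of the factor 4 lost in \<open>local\<close> and the factor
    2 lost in \<open>total\<close>.\<close>
  define t8 where "t8 = 8 * t"
  obtain m where m: "\<And>(E :: 'a rel) X. \<lbrakk>sym E; irrefl E; finite X; clique_free c E X; m \<le> card X\<rbrakk> \<Longrightarrow>
     card (stable_sets E X) \<le> 2 * card {I \<in> stable_sets E X. t8 \<le> card I}"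
    using most_stable_sets_large[of c t8] by blast
  \<comment> \<open>If fewer than \<open>m\<close> neighbours are available, there are at most
    \<open>2 ^ m\<close> alternatives to choosing \<open>v\<close>. A reward \<open>a\<close> for
    choosing \<open>v\<close> therefore still averages to at least a constant times
    \<open>t8\<close>.\<close>
  define a where "a = t8 * 2 ^ m"
  have "\<exists>W\<in>stable_sets E V. t * card V \<le> \<Delta> * card W"
    if E: "sym E" "irrefl E" and V: "finite V" "clique_free c E V"
      and deg: "\<forall>v\<in>V. card (nbrs E V v) \<le> \<Delta>" and "a \<le> \<Delta>" for E :: "'a rel" and V \<Delta>
  proof -
    let ?W = "stable_sets E V"
    \<comment> \<open>The score of \<open>v\<close> rewards both outcomes of the local dichotomy.
      Averaged over all stable sets it is at least \<open>t8 / 4\<close> at each vertex, while its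
      sum over the vertices is controlled by \<open>card W\<close>.\<close>
    define h where "h v W = (if v \<in> W then a else 0) + card (nbrs E V v \<inter> W)" for v W
    have fW: "finite ?W" using V by simp
    have local: "t8 * card ?W \<le> 4 * (\<Sum>W\<in>?W. h v W)" if v: "v \<in> V" for v
    proof -
      define N where "N = nbrs E V v"
      define f where "f W = W - insert v N" for W
      have N: "N \<subseteq> V" "v \<notin> N" "finite N"
        using V \<open>irrefl E\<close> by (auto simp: N_def nbrs_def irrefl_def)
      have fib: "t8 * card {W \<in> ?W. f W = S} \<le> 4 * (\<Sum>W\<in>{W \<in> ?W. f W = S}. h v W)"
        if S: "S \<in> f ` ?W" for S
      proof -
        define X where "X = {u \<in> N. \<forall>s\<in>S. (s, u) \<notin> E}"
        have SV: "S \<subseteq> V" "S \<inter> insert v N = {}" "stable_set E S"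
          using S by (auto simp: f_def stable_sets_def stable_set_def)
        have X: "finite X" "X \<subseteq> N" using N by (auto simp: X_def)
        have cX: "clique_free c E X" using V(2) X(2) N(1) clique_free_mono by blast
        have vS: "(v, s) \<notin> E" "(s, v) \<notin> E" if "s \<in> S" for s
          using SV that \<open>sym E\<close> by (auto simp: N_def nbrs_def dest: symD)
        have fib_eq: "{W \<in> ?W. f W = S} = insert (insert v S) ((\<union>) S ` stable_sets E X)" (is "?l = ?r")
        proof
          show "?l \<subseteq> ?r"
          proof
            fix W assume W: "W \<in> ?l"
            then have W': "W \<subseteq> V" "stable_set E W" "W - insert v N = S"
              by (auto simp: stable_sets_def f_def)
            show "W \<in> ?r"
            proof (cases "v \<in> W")
              case True
              then have "W \<inter> N = {}" using W' by (auto simp: N_def nbrs_def stable_set_def)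
              then have "W = insert v S" using W' True by auto
              then show ?thesis by simp
            next
              case False
              have "W \<inter> N \<in> stable_sets E X"
                using W' by (auto simp: stable_sets_def X_def stable_set_def)
              moreover have "W = S \<union> (W \<inter> N)" using W' False by auto
              ultimately show ?thesis by blast
            qed
          qed
          show "?r \<subseteq> ?l"
          proof
            fix W assume "W \<in> ?r"
            then consider "W = insert v S" | I where "I \<in> stable_sets E X" "W = S \<union> I" by blast
            then show "W \<in> ?l"
            proof cases
              case 1
              then show ?thesis
                using SV vS v \<open>irrefl E\<close> by (auto simp: stable_sets_def stable_set_def f_def irrefl_def)
            next
              case 2
              then have "I \<subseteq> X" "stable_set E I" by (auto simp: stable_sets_def)
              then have "stable_set E W"
                using 2 SV(3) symD[OF \<open>sym E\<close>] unfolding stable_set_def X_def by blast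
              moreover have "f W = S" "W \<subseteq> V"
                using 2 SV N X \<open>I \<subseteq> X\<close> by (auto simp: f_def)
              ultimately show ?thesis by (simp add: stable_sets_def)
            qed
          qed
        qed
        have disj: "I \<inter> S = {}" "v \<notin> I" if "I \<in> stable_sets E X" for I
          using that X SV N by (auto simp: stable_sets_def)
        have inj: "inj_on ((\<union>) S) (stable_sets E X)"
          by (rule inj_onI) (use disj in blast)
        have notin: "insert v S \<notin> (\<union>) S ` stable_sets E X"
          using disj SV by blast
        have fX: "finite (stable_sets E X)" using X by simp
        have hI: "h v (S \<union> I) = card I" if "I \<in> stable_sets E X" for I
        proof -
          have "nbrs E V v \<inter> (S \<union> I) = I"
            using that SV X unfolding N_def[symmetric] by (auto simp: stable_sets_def)
          then show ?thesis using disj[OF that] SV by (simp add: h_def)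
        qed
        have hv: "h v (insert v S) \<ge> a" by (simp add: h_def)
        let ?i = "card (stable_sets E X)"
        have card_eq: "card {W \<in> ?W. f W = S} = Suc ?i"
          unfolding fib_eq using fX notin by (simp add: card_image[OF inj])
        have sum_eq: "(\<Sum>W\<in>{W \<in> ?W. f W = S}. h v W) = h v (insert v S) + (\<Sum>I\<in>stable_sets E X. card I)"
          unfolding fib_eq using fX notin by (simp add: sum.reindex[OF inj] hI)
        have i1: "?i \<ge> 1"
          using fX empty_in_stable_sets[of E X] by (auto simp: Suc_le_eq card_gt_0_iff)
        have "t8 * Suc ?i \<le> 4 * (a + (\<Sum>I\<in>stable_sets E X. card I))"
        proof (cases "m \<le> card X")
          case True
          let ?L = "{I \<in> stable_sets E X. t8 \<le> card I}"
          have "t8 * card ?L = (\<Sum>I\<in>?L. t8)" by simp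
          also have "\<dots> \<le> (\<Sum>I\<in>?L. card I)" by (rule sum_mono) simp
          also have "\<dots> \<le> (\<Sum>I\<in>stable_sets E X. card I)"
            by (rule sum_mono2) (use fX in auto)
          finally have *: "t8 * card ?L \<le> (\<Sum>I\<in>stable_sets E X. card I)" .
          \<comment> \<open>\<open>Suc\<close> accounts for the outcome in which \<open>v\<close>
            itself is chosen. Since \<open>?i\<close> is positive, this costs a second factor
            2.\<close>
          have "Suc ?i \<le> 4 * card ?L"
            using m[OF E X(1) cX True] i1 by linarith
          then have "t8 * Suc ?i \<le> t8 * (4 * card ?L)" by (rule mult_left_mono) simp
          also have "\<dots> = 4 * (t8 * card ?L)" by (simp add: mult_ac)
          also have "\<dots> \<le> 4 * (a + (\<Sum>I\<in>stable_sets E X. card I))" using * by simp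
          finally show ?thesis .
        next
          case False
          have "?i \<le> card (Pow X)" by (rule card_mono) (use X in \<open>auto simp: stable_sets_def\<close>)
          also have "\<dots> = 2 ^ card X" using X by (simp add: card_Pow)
          also have "\<dots> \<le> 2 ^ m" using False by (intro power_increasing) auto
          finally have "Suc ?i \<le> 4 * 2 ^ m" using i1 by linarith
          then have "t8 * Suc ?i \<le> t8 * (4 * 2 ^ m)" by (rule mult_left_mono) simp
          also have "\<dots> = 4 * a" by (simp add: a_def)
          finally show ?thesis by (rule order_trans) simp
        qed
        also have "\<dots> \<le> 4 * (h v (insert v S) + (\<Sum>I\<in>stable_sets E X. card I))" using hv by simp
        finally show ?thesis unfolding card_eq sum_eq .
      qed
      have "t8 * card ?W = (\<Sum>S\<in>f ` ?W. t8 * card {W \<in> ?W. f W = S})"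
        using sum.image_gen[OF fW, of "\<lambda>_. 1::nat" f] by (simp add: sum_distrib_left)
      also have "\<dots> \<le> (\<Sum>S\<in>f ` ?W. 4 * (\<Sum>W\<in>{W \<in> ?W. f W = S}. h v W))"
        by (rule sum_mono) (rule fib)
      also have "\<dots> = 4 * (\<Sum>W\<in>?W. h v W)"
        using sum.image_gen[OF fW, of "h v" f] by (simp add: sum_distrib_left)
      finally show ?thesis .
    qed
    \<comment> \<open>The neighbour counts contribute \<open>\<Delta> * card W\<close> by the degree
      bound, and the rewards \<open>a\<close> contribute no more because
      \<open>a \<le> \<Delta>\<close>.\<close>
    have total: "(\<Sum>v\<in>V. h v W) \<le> 2 * \<Delta> * card W" if W: "W \<in> ?W" for W
    proof -
      have WV: "W \<subseteq> V" "finite W" using W V finite_subset by (auto simp: stable_sets_def)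
      have "(\<Sum>v\<in>V. card (nbrs E V v \<inter> W)) = (\<Sum>v\<in>V. \<Sum>u\<in>W. if (v, u) \<in> E then 1 else 0)"
        using WV by (intro sum.cong refl) (auto simp: nbrs_def sum.If_cases intro!: arg_cong[where f=card])
      also have "\<dots> = (\<Sum>u\<in>W. \<Sum>v\<in>V. if (v, u) \<in> E then 1 else 0)" by (rule sum.swap)
      also have "\<dots> = (\<Sum>u\<in>W. card (nbrs E V u))"
        using V \<open>sym E\<close> by (intro sum.cong refl) (auto simp: nbrs_def sum.If_cases dest: symD intro!: arg_cong[where f=card])
      also have "\<dots> \<le> (\<Sum>u\<in>W. \<Delta>)" by (rule sum_mono) (use deg WV in auto)
      finally have "(\<Sum>v\<in>V. card (nbrs E V v \<inter> W)) \<le> \<Delta> * card W" by (simp add: mult.commute)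
      moreover have "(\<Sum>v\<in>V. if v \<in> W then a else 0) = a * card W"
        using WV V by (simp add: sum.If_cases Int_absorb1 mult.commute)
      moreover have "a * card W \<le> \<Delta> * card W" using \<open>a \<le> \<Delta>\<close> by simp
      ultimately have "(\<Sum>v\<in>V. h v W) \<le> \<Delta> * card W + \<Delta> * card W"
        unfolding h_def sum.distrib by linarith
      then show ?thesis by (simp add: mult_2 distrib_right)
    qed
    show ?thesis
    proof (rule ccontr)
      \<comment> \<open>Averaging over all stable sets: if each were too small, the total score
        would fall below its lower bound from \<open>local\<close>. Strictness uses that the empty
        set is always among them.\<close>
      assume "\<not> ?thesis"
      then have less: "\<Delta> * card W < t * card V" if "W \<in> ?W" for W using that by force
      have "t8 * card V * card ?W = (\<Sum>v\<in>V. t8 * card ?W)" by simp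
      also have "\<dots> \<le> (\<Sum>v\<in>V. 4 * (\<Sum>W\<in>?W. h v W))" by (rule sum_mono) (rule local)
      also have "\<dots> = 4 * (\<Sum>v\<in>V. \<Sum>W\<in>?W. h v W)" by (simp add: sum_distrib_left)
      also have "\<dots> = 4 * (\<Sum>W\<in>?W. \<Sum>v\<in>V. h v W)" by (subst sum.swap) simp
      also have "\<dots> \<le> 4 * (\<Sum>W\<in>?W. 2 * \<Delta> * card W)"
        by (intro mult_left_mono sum_mono total) auto
      also have "\<dots> = 8 * (\<Sum>W\<in>?W. \<Delta> * card W)"
        by (simp add: sum_distrib_left mult.assoc)
      also have "\<dots> < 8 * (\<Sum>W\<in>?W. t * card V)"
        using empty_in_stable_sets[of E V] fW
        by (intro mult_strict_left_mono sum_strict_mono less) auto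
      also have "\<dots> = t8 * card V * card ?W" by (simp add: t8_def)
      finally show False by simp
    qed
  qed
  then show ?thesis by blast
qed

subsection \<open>Random sampling along a degeneracy order\<close>

text \<open>Only induced subgraphs are tested, which is enough because deleting edges lowers
  degrees.\<close>

definition degenerate :: "nat \<Rightarrow> 'a rel \<Rightarrow> 'a set \<Rightarrow> bool" where
  "degenerate d E V \<longleftrightarrow> (\<forall>S\<subseteq>V. S \<noteq> {} \<longrightarrow> (\<exists>v\<in>S. card (nbrs E S v) \<le> d))"

lemma degenerate_mono: "degenerate d E V \<Longrightarrow> U \<subseteq> V \<Longrightarrow> degenerate d E U"
  unfolding degenerate_def using subset_trans by metis

definition forward :: "('a \<Rightarrow> nat) \<Rightarrow> 'a rel \<Rightarrow> 'a set \<Rightarrow> 'a \<Rightarrow> 'a set" where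
  "forward rank E S v = {u \<in> nbrs E S v. rank v < rank u}"

lemma degenerate_rank:
  assumes "finite V" "degenerate d E V"
  shows "\<exists>rank. inj_on rank V \<and> (\<forall>v\<in>V. card (forward rank E V v) \<le> d)"
  using assms
proof (induction V rule: finite_psubset_induct)
  case (psubset V)
  show ?case
  proof (cases "V = {}")
    case True
    then show ?thesis by simp
  next
    case False
    then obtain v where v: "v \<in> V" "card (nbrs E V v) \<le> d"
      using psubset.prems(1) unfolding degenerate_def by blast
    have "V - {v} \<subset> V" using v by blast
    moreover have "degenerate d E (V - {v})"
      using psubset.prems(1) by (rule degenerate_mono) blast
    ultimately obtain r where r: "inj_on r (V - {v})" "\<forall>u\<in>V - {v}. card (forward r E (V - {v}) u) \<le> d"
      using psubset.IH by metis
    \<comment> \<open>The removed vertex comes first, so all its remaining neighbours are forward,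
      and it is forward of nobody.\<close>
    define rank where "rank x = (if x = v then 0 else Suc (r x))" for x
    have "inj_on rank V"
      using r(1) by (auto simp: inj_on_def rank_def)
    moreover have "card (forward rank E V u) \<le> d" if u: "u \<in> V" for u
    proof (cases "u = v")
      case True
      have "card (forward rank E V u) \<le> card (nbrs E V v)"
        by (rule card_mono) (use psubset.hyps True in \<open>auto simp: forward_def\<close>)
      then show ?thesis using v by simp
    next
      case False
      have "forward rank E V u = forward r E (V - {v}) u"
        using False by (auto simp: forward_def nbrs_def rank_def split: if_splits)
      then show ?thesis using r(2) u False by simp
    qed
    ultimately show ?thesis by blast
  qed
qed

text \<open>Each neighbour lies forward or backward, and by double counting the backward degrees
  have the same sum as the forward ones.\<close>

lemma degree_sum_le:
  assumes V: "finite V" and E: "sym E" "irrefl E"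
    and rank: "inj_on rank V" "\<And>v. v \<in> V \<Longrightarrow> card (forward rank E V v) \<le> d"
  shows "(\<Sum>v\<in>V. card (nbrs E V v)) \<le> 2 * d * card V"
proof -
  let ?b = "\<lambda>v. {u \<in> nbrs E V v. rank u < rank v}"
  have "(\<Sum>v\<in>V. card (?b v)) = (\<Sum>v\<in>V. \<Sum>u\<in>V. if (v, u) \<in> E \<and> rank u < rank v then 1 else 0)"
    using V by (intro sum.cong refl) (auto simp: nbrs_def sum.If_cases intro!: arg_cong[where f=card])
  also have "\<dots> = (\<Sum>u\<in>V. \<Sum>v\<in>V. if (v, u) \<in> E \<and> rank u < rank v then 1 else 0)" by (rule sum.swap)
  also have "\<dots> = (\<Sum>u\<in>V. card (forward rank E V u))"
    using V E(1) by (intro sum.cong refl)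
      (auto simp: nbrs_def forward_def sum.If_cases dest: symD intro!: arg_cong[where f=card])
  finally have b: "(\<Sum>v\<in>V. card (?b v)) = (\<Sum>u\<in>V. card (forward rank E V u))" .
  have "(\<Sum>v\<in>V. card (nbrs E V v)) \<le> (\<Sum>v\<in>V. card (forward rank E V v) + card (?b v))"
  proof (rule sum_mono)
    fix v assume v: "v \<in> V"
    have "nbrs E V v \<subseteq> forward rank E V v \<union> ?b v"
    proof
      fix u assume u: "u \<in> nbrs E V v"
      then have "u \<in> V" "u \<noteq> v" using E(2) by (auto simp: nbrs_def irrefl_def)
      then have "rank u \<noteq> rank v" using rank(1) v by (auto dest: inj_onD)
      then show "u \<in> forward rank E V v \<union> ?b v" using u by (auto simp: forward_def)
    qed
    then have "card (nbrs E V v) \<le> card (forward rank E V v \<union> ?b v)"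
      by (rule card_mono[rotated]) (use V in \<open>auto simp: forward_def\<close>)
    also have "\<dots> \<le> card (forward rank E V v) + card (?b v)" by (rule card_Un_le)
    finally show "card (nbrs E V v) \<le> card (forward rank E V v) + card (?b v)" .
  qed
  also have "\<dots> = 2 * (\<Sum>v\<in>V. card (forward rank E V v))" by (simp add: sum.distrib b)
  also have "\<dots> \<le> 2 * (\<Sum>v\<in>V. d)" using rank(2) by (intro mult_left_mono sum_mono) auto
  finally show ?thesis by (simp add: mult_ac)
qed

section \<open>Independent sampling of vertices\<close>

definition weight :: "real \<Rightarrow> 'a set \<Rightarrow> 'a set \<Rightarrow> real" where
  "weight p V R = p ^ card R * (1 - p) ^ card (V - R)"

text \<open>\<open>weight p V R\<close> is the probability that sampling each vertex of
  \<open>V\<close> independently with probability \<open>p\<close> yields exactly \<open>R\<close>.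
  The sum is thus the probability that the sample contains \<open>T\<close> and avoids
  \<open>F\<close>.\<close>

lemma sum_weight_between:
  assumes V: "finite V" and TF: "T \<subseteq> V" "F \<subseteq> V" "T \<inter> F = {}"
  shows "(\<Sum>R | T \<subseteq> R \<and> R \<subseteq> V - F. weight p V R) = p ^ card T * (1 - p) ^ card F"
proof -
  \<comment> \<open>Putting factor 0 on choosing an element of \<open>F\<close> or omitting one of
    \<open>T\<close> kills the unwanted terms, so the sum may run over all subsets and factors as a
    product over the vertices.\<close>
  define f where "f x = (if x \<in> F then 0 else p)" for x
  define g where "g x = (if x \<in> T then 0 else 1 - p)" for x
  have "(\<Sum>R | T \<subseteq> R \<and> R \<subseteq> V - F. weight p V R) = (\<Sum>R\<in>Pow V. prod f R * prod g (V - R))"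
  proof (rule sum.mono_neutral_cong_left)
    show "\<forall>R\<in>Pow V - {R. T \<subseteq> R \<and> R \<subseteq> V - F}. prod f R * prod g (V - R) = 0"
    proof
      fix R assume R: "R \<in> Pow V - {R. T \<subseteq> R \<and> R \<subseteq> V - F}"
      then have fR: "finite R" "finite (V - R)" using V finite_subset by auto
      from R consider x where "x \<in> T" "x \<in> V - R" | x where "x \<in> R" "x \<in> F" using TF by blast
      then show "prod f R * prod g (V - R) = 0"
      proof cases
        case 1
        then have "prod g (V - R) = 0" using fR by (auto simp: g_def intro!: prod_zero)
        then show ?thesis by simp
      next
        case 2
        then have "prod f R = 0" using fR by (auto simp: f_def intro!: prod_zero)
        then show ?thesis by simp
      qed
    qed
    fix R assume R: "R \<in> {R. T \<subseteq> R \<and> R \<subseteq> V - F}"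
    have "prod f R = (\<Prod>x\<in>R. p)" by (rule prod.cong) (use R in \<open>auto simp: f_def\<close>)
    moreover have "prod g (V - R) = (\<Prod>x\<in>V - R. 1 - p)"
      by (rule prod.cong) (use R in \<open>auto simp: g_def\<close>)
    ultimately show "weight p V R = prod f R * prod g (V - R)" by (simp add: weight_def)
  qed (use V in auto)
  also have "\<dots> = (\<Prod>x\<in>V. f x + g x)" by (rule prod_add[OF V, symmetric])
  also have "\<dots> = (\<Prod>x\<in>V. if x \<in> T then p else if x \<in> F then 1 - p else 1)"
    by (rule prod.cong) (use TF in \<open>auto simp: f_def g_def\<close>)
  also have "\<dots> = p ^ card (V \<inter> T) * (1 - p) ^ card (V \<inter> - T \<inter> F)"
    using V by (simp add: prod.If_cases)
  also have "V \<inter> T = T" using TF by blast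
  also have "V \<inter> - T \<inter> F = F" using TF by blast
  finally show ?thesis .
qed

text \<open>Linearity of expectation over the vertices.\<close>

lemma expected_card:
  assumes V: "finite V"
  shows "(\<Sum>R\<in>Pow V. weight p V R * card R) = p * card V"
proof -
  have "(\<Sum>R\<in>Pow V. weight p V R * card R) = (\<Sum>R\<in>Pow V. \<Sum>v\<in>V. if v \<in> R then weight p V R else 0)"
  proof (rule sum.cong[OF refl])
    fix R assume "R \<in> Pow V"
    then have "V \<inter> R = R" by blast
    then show "weight p V R * card R = (\<Sum>v\<in>V. if v \<in> R then weight p V R else 0)"
      using V by (simp add: sum.If_cases)
  qed
  also have "\<dots> = (\<Sum>v\<in>V. \<Sum>R\<in>Pow V. if v \<in> R then weight p V R else 0)" by (rule sum.swap)
  also have "\<dots> = (\<Sum>v\<in>V. p)"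
  proof (rule sum.cong[OF refl])
    fix v assume "v \<in> V"
    have "(\<Sum>R\<in>Pow V. if v \<in> R then weight p V R else 0) = (\<Sum>R | {v} \<subseteq> R \<and> R \<subseteq> V - {}. weight p V R)"
      using V by (simp add: sum.If_cases) (auto intro: sum.cong)
    also have "\<dots> = p" using sum_weight_between[OF V, of "{v}" "{}" p] \<open>v \<in> V\<close> by simp
    finally show "(\<Sum>R\<in>Pow V. if v \<in> R then weight p V R else 0) = p" .
  qed
  finally show ?thesis by (simp add: mult.commute)
qed

text \<open>With sampling probability \<open>1 / d\<close>, avoiding O(d) prescribed vertices has
  probability bounded below independently of \<open>d\<close>. The estimate ln(1 - x) \<ge> -x -
  2x^2 at x = 1/d gives the exponent -1 - 2/d, which is at least -2.\<close>

lemma one_minus_inverse_power_ge: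
  assumes "d \<ge> (2::nat)"
  shows "exp (- 2) \<le> (1 - 1 / real d) ^ d"
proof -
  let ?x = "1 / real d"
  have x: "0 \<le> ?x" "?x \<le> 1 / 2" using assms by (auto simp: field_simps)
  have "- ?x - 2 * ?x\<^sup>2 \<le> ln (1 - ?x)" using ln_one_minus_pos_lower_bound[OF x] .
  then have "real d * (- ?x - 2 * ?x\<^sup>2) \<le> real d * ln (1 - ?x)"
    by (rule mult_left_mono) simp
  moreover have "real d * (- ?x - 2 * ?x\<^sup>2) = - 1 - 2 * ?x"
    using assms by (simp add: field_simps power2_eq_square)
  ultimately have "- 2 \<le> real d * ln (1 - ?x)" using x by linarith
  also have "\<dots> = ln ((1 - ?x) ^ d)" using x by (subst ln_realpow) auto
  finally have "exp (- 2) \<le> exp (ln ((1 - ?x) ^ d))" by simp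
  also have "\<dots> = (1 - ?x) ^ d" using x by (intro exp_ln zero_less_power) linarith
  finally show ?thesis .
qed

section \<open>Stable cores of samples and the vertices attached to them\<close>

definition core :: "('a \<Rightarrow> nat) \<Rightarrow> 'a rel \<Rightarrow> 'a set \<Rightarrow> 'a set" where
  "core rank E R = {u \<in> R. forward rank E R u = {}}"

text \<open>On an edge inside the core, the endpoint of smaller rank would have a sampled forward
  neighbour. The core is the stable set called \<open>R\<close> in the overview; here
  \<open>R\<close> is the whole sample.\<close>

lemma stable_set_core:
  assumes "sym E" "irrefl E" "inj_on rank V" "R \<subseteq> V"
  shows "stable_set E (core rank E R)"
  unfolding stable_set_def
proof (intro ballI notI)
  fix u v assume uv: "u \<in> core rank E R" "v \<in> core rank E R" "(u, v) \<in> E"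
  then have R: "u \<in> R" "v \<in> R" "u \<noteq> v" using assms(2) by (auto simp: core_def irrefl_def)
  then have "rank u \<noteq> rank v" using assms(3,4) by (auto dest: inj_onD)
  moreover have "(v, u) \<in> E" using uv assms(1) by (auto dest: symD)
  ultimately show False
    using uv R unfolding core_def forward_def nbrs_def by (cases "rank u" "rank v" rule: linorder_cases) auto
qed

text \<open>This is the version with in-neighbours in \<open>R\<close>; replacing \<open>D\<close>
  by \<open>D\<inverse>\<close> gives the version with out-neighbours.\<close>

definition attached :: "nat \<Rightarrow> 'a rel \<Rightarrow> 'a set \<Rightarrow> 'a \<Rightarrow> bool" where
  "attached k D R q \<longleftrightarrow> q \<notin> R \<and> k \<le> card (nbrs (D\<inverse>) R q) \<and> nbrs D R q = {}"

text \<open>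
  For a stable \<open>k\<close>-set \<open>T\<close> of in-neighbours of \<open>q\<close>, let \<open>F\<close> consist of \<open>q\<close>, its other neighbours and
  the forward neighbours of \<open>T\<close>. If a sample contains \<open>T\<close> and avoids \<open>F\<close>, then \<open>q\<close> is attached; these
  events are disjoint for distinct \<open>T\<close>, and \<open>card F = O(d)\<close>.
\<close>

lemma attached_probability:
  assumes k: "k > 0"
  obtains \<alpha> d0 where "\<alpha> > 0" and "\<And>(D :: 'a rel) V rank d q. \<lbrakk>finite V; asym D; clique_free c (D \<union> D\<inverse>) V; d0 \<le> d;
    \<forall>v\<in>V. card (forward rank (D \<union> D\<inverse>) V v) \<le> d; q \<in> V;
    d \<le> 2 * card (nbrs (D\<inverse>) V q); card (nbrs (D \<union> D\<inverse>) V q) \<le> 4 * d\<rbrakk> \<Longrightarrow>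
    \<alpha> \<le> (\<Sum>R | R \<subseteq> V \<and> attached k D (core rank (D \<union> D\<inverse>) R) q. weight (1 / real d) V R)"
proof -
  obtain r where "r \<ge> k" and r: "\<And>(E :: 'a rel) N. \<lbrakk>sym E; irrefl E; finite N; clique_free c E N; r \<le> card N\<rbrakk> \<Longrightarrow>
     card N choose k \<le> card {T \<in> stable_sets E N. card T = k} * (r choose k)"
    using many_stable_subsets[of k c] by blast
  \<comment> \<open>There are at least \<open>(d / (2 * k)) ^ k / (r choose k)\<close> stable sets
    \<open>T\<close>, and each event has probability at least
    \<open>p ^ k * exp (- 2) ^ (k + 5)\<close>. The powers of \<open>d\<close> cancel since
    \<open>p = 1 / d\<close>.\<close>
  define \<alpha> where "\<alpha> = (1 / (2 * real k)) ^ k / real (r choose k) * exp (- 2) ^ (k + 5)"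
  have rk: "real (r choose k) > 0" using \<open>r \<ge> k\<close> by simp
  then have "\<alpha> > 0" using k by (simp add: \<alpha>_def)
  moreover have "\<alpha> \<le> (\<Sum>R | R \<subseteq> V \<and> attached k D (core rank (D \<union> D\<inverse>) R) q. weight (1 / real d) V R)"
    if V: "finite V" and D: "asym D" and cf: "clique_free c (D \<union> D\<inverse>) V" and d: "2 * r + 2 \<le> d"
      and fw: "\<forall>v\<in>V. card (forward rank (D \<union> D\<inverse>) V v) \<le> d" and q: "q \<in> V"
      and qin: "d \<le> 2 * card (nbrs (D\<inverse>) V q)" and qdeg: "card (nbrs (D \<union> D\<inverse>) V q) \<le> 4 * d"
    for D :: "'a rel" and V rank d q
  proof -
    define E where "E = D \<union> D\<inverse>"
    define p where "p = 1 / real d"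
    define N where "N = nbrs (D\<inverse>) V q"
    define \<T> where "\<T> = {T \<in> stable_sets E N. card T = k}"
    define F where "F T = (\<Union>u\<in>T. forward rank E V u) \<union> insert q (nbrs E V q) - T" for T
    define A where "A T = {R. T \<subseteq> R \<and> R \<subseteq> V - F T}" for T
    have E: "sym E" "irrefl E" using D by (auto simp: E_def sym_def irrefl_def dest: asymD)
    have N: "N \<subseteq> V" "finite N" "N \<subseteq> nbrs E V q" "q \<notin> N"
      using V D by (auto simp: N_def nbrs_def E_def dest: asymD)
    have p: "0 < p" "p < 1" using d by (auto simp: p_def)
    have T: "T \<subseteq> N" "stable_set E T" "card T = k" "finite T" if "T \<in> \<T>" for T
      using that N(2) finite_subset by (auto simp: \<T>_def stable_sets_def)
    have FV: "F T \<subseteq> V" "T \<inter> F T = {}" "finite (F T)" if "T \<in> \<T>" for T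
    proof -
      show "F T \<subseteq> V" using q by (auto simp: F_def forward_def nbrs_def)
      then show "finite (F T)" using V finite_subset by blast
    qed (auto simp: F_def)
    \<comment> \<open>The event determines the sampled neighbours of \<open>q\<close>. This gives
      disjointness for distinct \<open>T\<close> and also rules out sampled out-neighbours.\<close>
    have trace: "R \<inter> nbrs E V q = T" if "T \<in> \<T>" "R \<in> A T" for R T
      using that T[OF that(1)] N(3) by (auto simp: A_def F_def)
    have disj: "A T \<inter> A T' = {}" if "T \<in> \<T>" "T' \<in> \<T>" "T \<noteq> T'" for T T'
      using trace[OF that(1)] trace[OF that(2)] that(3) by fastforce
    have sub: "R \<subseteq> V \<and> attached k D (core rank E R) q" if TT: "T \<in> \<T>" and R: "R \<in> A T" for T R
    proof -
      note T' = T[OF TT]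
      have TR: "T \<subseteq> R" "R \<subseteq> V" "R \<inter> F T = {}" using R by (auto simp: A_def)
      have qR: "q \<notin> R" using TR T' N(4) by (auto simp: F_def)
      have core: "T \<subseteq> core rank E R"
      proof
        fix u assume u: "u \<in> T"
        have "forward rank E R u \<subseteq> T"
          using u TR by (auto simp: F_def forward_def nbrs_def)
        moreover have "forward rank E R u \<inter> T = {}"
          using u T'(2) by (auto simp: forward_def nbrs_def stable_set_def)
        ultimately show "u \<in> core rank E R" using u TR by (auto simp: core_def)
      qed
      have cR: "core rank E R \<subseteq> R" by (auto simp: core_def)
      have "T \<subseteq> nbrs (D\<inverse>) (core rank E R) q"
        using core T'(1) by (auto simp: N_def nbrs_def)
      then have "k \<le> card (nbrs (D\<inverse>) (core rank E R) q)"
        using T'(3) card_mono[of "nbrs (D\<inverse>) (core rank E R) q" T] finite_subset[OF TR(2) V]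
          finite_subset[OF cR] by auto
      moreover have "nbrs D (core rank E R) q = {}"
      proof (rule ccontr)
        assume "nbrs D (core rank E R) q \<noteq> {}"
        then obtain x where x: "x \<in> R" "(q, x) \<in> D" using cR by (auto simp: nbrs_def)
        then have "x \<in> R \<inter> nbrs E V q" using TR by (auto simp: nbrs_def E_def)
        then have "x \<in> N" using trace[OF TT R] T'(1) by auto
        then show False using x D by (auto simp: N_def nbrs_def dest: asymD)
      qed
      ultimately show ?thesis using TR qR cR by (auto simp: attached_def)
    qed
    \<comment> \<open>The \<open>k\<close> vertices of \<open>T\<close> contribute at most
      \<open>k * d\<close> forward neighbours and the closed neighbourhood of \<open>q\<close> at
      most \<open>4 * d + 1\<close>; the 1 is absorbed by a fifth \<open>d\<close>.\<close>
    have cardF: "card (F T) \<le> (k + 5) * d" if TT: "T \<in> \<T>" for T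
    proof -
      note T' = T[OF TT]
      have "card (F T) \<le> card ((\<Union>u\<in>T. forward rank E V u) \<union> insert q (nbrs E V q))"
        unfolding F_def by (rule card_mono) (use T'(4) V in \<open>auto simp: forward_def\<close>)
      also have "\<dots> \<le> card (\<Union>u\<in>T. forward rank E V u) + card (insert q (nbrs E V q))"
        by (rule card_Un_le)
      also have "card (insert q (nbrs E V q)) \<le> 4 * d + 1"
        using qdeg V by (simp add: E_def card_insert_if)
      also have "card (\<Union>u\<in>T. forward rank E V u) \<le> (\<Sum>u\<in>T. card (forward rank E V u))"
        by (rule card_UN_le[OF T'(4)])
      also have "\<dots> \<le> (\<Sum>u\<in>T. d)"
        by (rule sum_mono) (use fw T'(1) N(1) in \<open>auto simp: E_def\<close>)
      finally show ?thesis using T'(3) d by (simp add: algebra_simps)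
    qed
    have "card N choose k \<le> card \<T> * (r choose k)"
      unfolding \<T>_def
    proof (rule r[OF E N(2)])
      show "clique_free c E N" using cf N(1) clique_free_mono by (auto simp: E_def)
      show "r \<le> card N" using qin d by (simp add: N_def)
    qed
    then have "real (card N choose k) \<le> card \<T> * real (r choose k)"
      by (metis of_nat_le_iff of_nat_mult)
    moreover have "(real (card N) / real k) ^ k \<le> real (card N choose k)"
      by (rule binomial_ge_n_over_k_pow_k) (use qin d \<open>r \<ge> k\<close> in \<open>simp add: N_def\<close>)
    moreover have "(real d / (2 * real k)) ^ k \<le> (real (card N) / real k) ^ k"
      using qin k by (intro power_mono) (auto simp: N_def field_simps)
    ultimately have "(real d / (2 * real k)) ^ k \<le> card \<T> * real (r choose k)" by linarith
    then have many: "(real d / (2 * real k)) ^ k / real (r choose k) \<le> card \<T>"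
      using rk by (simp only: pos_divide_le_eq)
    have "exp (- 2) ^ (k + 5) \<le> ((1 - p) ^ d) ^ (k + 5)"
      unfolding p_def by (rule power_mono[OF one_minus_inverse_power_ge]) (use d in auto)
    also have "\<dots> = (1 - p) ^ ((k + 5) * d)" by (simp add: power_mult[symmetric] mult.commute)
    finally have ex: "exp (- 2) ^ (k + 5) \<le> (1 - p) ^ ((k + 5) * d)" .
    have "\<alpha> = (real d / (2 * real k)) ^ k / real (r choose k) * p ^ k * exp (- 2) ^ (k + 5)"
      using d by (simp add: \<alpha>_def p_def power_divide)
    also have "\<dots> \<le> card \<T> * p ^ k * (1 - p) ^ ((k + 5) * d)"
      by (intro mult_mono many ex) (use p in auto)
    also have "\<dots> = (\<Sum>T\<in>\<T>. p ^ k * (1 - p) ^ ((k + 5) * d))" by simp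
    also have "\<dots> \<le> (\<Sum>T\<in>\<T>. \<Sum>R\<in>A T. weight p V R)"
    proof (rule sum_mono)
      fix T assume TT: "T \<in> \<T>"
      have "(\<Sum>R\<in>A T. weight p V R) = p ^ k * (1 - p) ^ card (F T)"
        unfolding A_def using sum_weight_between[OF V _ FV(1,2)[OF TT]] T[OF TT] N(1) by auto
      moreover have "(1 - p) ^ ((k + 5) * d) \<le> (1 - p) ^ card (F T)"
        by (rule power_decreasing[OF cardF[OF TT]]) (use p in auto)
      ultimately show "p ^ k * (1 - p) ^ ((k + 5) * d) \<le> (\<Sum>R\<in>A T. weight p V R)"
        using p by simp
    qed
    also have "\<dots> = (\<Sum>R\<in>(\<Union>T\<in>\<T>. A T). weight p V R)"
    proof (rule sum.UNION_disjoint[symmetric])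
      show "finite \<T>" using N(2) by (simp add: \<T>_def)
      show "\<forall>T\<in>\<T>. finite (A T)"
        using V by (auto simp: A_def intro: finite_subset[of _ "Pow V"])
    qed (use disj in auto)
    also have "\<dots> \<le> (\<Sum>R | R \<subseteq> V \<and> attached k D (core rank E R) q. weight p V R)"
      by (rule sum_mono2) (use V sub p in \<open>auto simp: weight_def intro: finite_subset[of _ "Pow V"]\<close>)
    finally show ?thesis by (simp add: E_def p_def)
  qed
  ultimately show thesis by (rule that)
qed

text \<open>A first-moment argument. One inequality carries two facts: dropping
  \<open>d * card R\<close> shows that \<open>Q'\<close> is a positive fraction of \<open>Q\<close>,
  and dropping \<open>card V\<close> bounds \<open>R\<close> in terms of \<open>Q'\<close>.\<close>

lemma sampling:
  assumes k: "k > 0"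
  obtains \<alpha> :: real and d0 where "\<alpha> > 0" and "\<And>(D :: 'a rel) V rank d Q. \<lbrakk>finite V; asym D; clique_free c (D \<union> D\<inverse>) V; d0 \<le> d;
    inj_on rank V; \<forall>v\<in>V. card (forward rank (D \<union> D\<inverse>) V v) \<le> d; Q \<subseteq> V;
    \<forall>q\<in>Q. d \<le> 2 * card (nbrs (D\<inverse>) V q) \<and> card (nbrs (D \<union> D\<inverse>) V q) \<le> 4 * d\<rbrakk> \<Longrightarrow>
    (\<exists>R\<subseteq>V. \<exists>Q'\<subseteq>Q. stable_set (D \<union> D\<inverse>) R \<and> (\<forall>q\<in>Q'. attached k D R q) \<and>
       \<alpha> * card Q * (card V + d * card R) \<le> card Q' * card V)"
proof -
  obtain \<alpha> d0 where "\<alpha> > 0" and prob: "\<And>(D :: 'a rel) V rank d q. \<lbrakk>finite V; asym D; clique_free c (D \<union> D\<inverse>) V; d0 \<le> d;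
    \<forall>v\<in>V. card (forward rank (D \<union> D\<inverse>) V v) \<le> d; q \<in> V;
    d \<le> 2 * card (nbrs (D\<inverse>) V q); card (nbrs (D \<union> D\<inverse>) V q) \<le> 4 * d\<rbrakk> \<Longrightarrow>
    \<alpha> \<le> (\<Sum>R | R \<subseteq> V \<and> attached k D (core rank (D \<union> D\<inverse>) R) q. weight (1 / real d) V R)"
    by (rule attached_probability[OF k]) (rule that)
  have "\<exists>R\<subseteq>V. \<exists>Q'\<subseteq>Q. stable_set (D \<union> D\<inverse>) R \<and> (\<forall>q\<in>Q'. attached k D R q) \<and>
       \<alpha> / 2 * card Q * (card V + d * card R) \<le> card Q' * card V"
    if V: "finite V" and D: "asym D" and cf: "clique_free c (D \<union> D\<inverse>) V" and d: "d0 + 2 \<le> d"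
      and rank: "inj_on rank V" and fw: "\<forall>v\<in>V. card (forward rank (D \<union> D\<inverse>) V v) \<le> d" and Q: "Q \<subseteq> V"
      and qs: "\<forall>q\<in>Q. d \<le> 2 * card (nbrs (D\<inverse>) V q) \<and> card (nbrs (D \<union> D\<inverse>) V q) \<le> 4 * d"
    for D :: "'a rel" and V rank d Q
  proof -
    define E where "E = D \<union> D\<inverse>"
    define p where "p = 1 / real d"
    define C where "C R = core rank E R" for R
    define Q' where "Q' R = {q \<in> Q. attached k D (C R) q}" for R
    define w where "w R = weight p V R" for R
    have E: "sym E" "irrefl E" using D by (auto simp: E_def sym_def irrefl_def dest: asymD)
    have p: "0 < p" "p < 1" "d * p = 1" using d by (auto simp: p_def)
    have w: "w R > 0" for R using p by (simp add: w_def weight_def)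
    have fQ: "finite Q" using Q V finite_subset by blast
    have EQ: "\<alpha> * card Q \<le> (\<Sum>R\<in>Pow V. w R * card (Q' R))"
    proof -
      have "\<alpha> * card Q = (\<Sum>q\<in>Q. \<alpha>)" by simp
      also have "\<dots> \<le> (\<Sum>q\<in>Q. \<Sum>R | R \<subseteq> V \<and> attached k D (C R) q. w R)"
        unfolding w_def C_def E_def p_def
        by (rule sum_mono, rule prob) (use V D cf d fw Q qs in auto)
      also have "\<dots> = (\<Sum>q\<in>Q. \<Sum>R\<in>Pow V. if attached k D (C R) q then w R else 0)"
        using V by (simp add: sum.inter_filter[symmetric])
      also have "\<dots> = (\<Sum>R\<in>Pow V. \<Sum>q\<in>Q. if attached k D (C R) q then w R else 0)"
        by (rule sum.swap)
      also have "\<dots> = (\<Sum>R\<in>Pow V. w R * card (Q' R))"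
        using fQ by (intro sum.cong refl) (simp add: sum.If_cases Q'_def Int_def)
      finally show ?thesis .
    qed
    have ER: "(\<Sum>R\<in>Pow V. w R * card (C R)) \<le> p * card V"
    proof -
      have "(\<Sum>R\<in>Pow V. w R * card (C R)) \<le> (\<Sum>R\<in>Pow V. w R * card R)"
      proof (rule sum_mono)
        fix R assume "R \<in> Pow V"
        then have "finite R" using V finite_subset by auto
        then have "card (C R) \<le> card R" by (intro card_mono) (auto simp: C_def core_def)
        then show "w R * card (C R) \<le> w R * card R" using less_imp_le[OF w] by (simp add: mult_left_mono)
      qed
      then show ?thesis using expected_card[OF V, of p] by (simp add: w_def)
    qed
    have total: "(\<Sum>R\<in>Pow V. w R) = 1"
      using sum_weight_between[OF V, of "{}" "{}" p] by (simp add: w_def Pow_def)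
    \<comment> \<open>The expectation of \<open>card V + d * card (C R)\<close> is at most
      \<open>2 * card V\<close>, which is why \<open>\<alpha>\<close> is halved. If every sample
      failed, taking expectations would contradict \<open>EQ\<close>.\<close>
    have "\<exists>R\<in>Pow V. \<alpha> / 2 * card Q * (card V + d * card (C R)) \<le> card (Q' R) * card V"
    proof (rule ccontr)
      let ?l = "\<lambda>R. real (card (Q' R)) * card V" and ?r = "\<lambda>R. \<alpha> / 2 * card Q * (card V + d * card (C R))"
      assume "\<not> ?thesis"
      then have less: "w R * ?l R < w R * ?r R" if "R \<in> Pow V" for R
        using that w[of R] by (intro mult_strict_left_mono) (auto simp: not_le)
      have "\<alpha> * card Q * card V \<le> (\<Sum>R\<in>Pow V. w R * card (Q' R)) * card V"
        by (rule mult_right_mono[OF EQ]) simp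
      also have "\<dots> = (\<Sum>R\<in>Pow V. w R * ?l R)" by (simp add: sum_distrib_right mult.assoc)
      also have "\<dots> < (\<Sum>R\<in>Pow V. w R * ?r R)"
        by (rule sum_strict_mono) (use less V in auto)
      also have "\<dots> = \<alpha> / 2 * card Q * (card V * (\<Sum>R\<in>Pow V. w R) + d * (\<Sum>R\<in>Pow V. w R * card (C R)))"
        by (simp add: sum_distrib_left sum.distrib[symmetric] algebra_simps)
      also have "\<dots> \<le> \<alpha> / 2 * card Q * (card V * 1 + d * (p * card V))"
        unfolding total using \<open>\<alpha> > 0\<close> mult_left_mono[OF ER, of d]
        by (intro mult_left_mono add_left_mono) auto
      also have "\<dots> = \<alpha> * card Q * card V"
        using p(3) by (simp add: mult.assoc[symmetric])
      finally show False by simp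
    qed
    then obtain R where R: "R \<subseteq> V" "\<alpha> / 2 * card Q * (card V + d * card (C R)) \<le> card (Q' R) * card V"
      by blast
    have "C R \<subseteq> V" "Q' R \<subseteq> Q" using R by (auto simp: C_def core_def Q'_def)
    moreover have "stable_set E (C R)" unfolding C_def by (rule stable_set_core[OF E rank R(1)])
    moreover have "\<forall>q\<in>Q' R. attached k D (C R) q" by (simp add: Q'_def)
    ultimately show ?thesis using R(2) unfolding E_def by blast
  qed
  then show thesis using \<open>\<alpha> > 0\<close> by (intro that[of "\<alpha> / 2" "d0 + 2"]) simp_all
qed

text \<open>The attached vertices found by sampling induce a clique-free graph of maximum degree at
  most \<open>4 * d\<close>. A stable set \<open>W\<close> among them of size at least
  \<open>t / (4 * d)\<close> times their number overtakes \<open>R\<close> once \<open>t\<close> is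
  large.\<close>

lemma attached_pair:
  assumes k: "k > 0"
  obtains d0 where "\<And>(D :: 'a rel) V rank d Q. \<lbrakk>finite V; V \<noteq> {}; asym D; clique_free c (D \<union> D\<inverse>) V; d0 \<le> d;
    inj_on rank V; \<forall>v\<in>V. card (forward rank (D \<union> D\<inverse>) V v) \<le> d; Q \<subseteq> V; card V \<le> 4 * card Q;
    \<forall>q\<in>Q. d \<le> 2 * card (nbrs (D\<inverse>) V q) \<and> card (nbrs (D \<union> D\<inverse>) V q) \<le> 4 * d\<rbrakk> \<Longrightarrow>
    \<exists>R\<subseteq>V. \<exists>W\<subseteq>V. W \<noteq> {} \<and> card R \<le> card W \<and> stable_set (D \<union> D\<inverse>) R \<and> stable_set (D \<union> D\<inverse>) W \<and>
      (\<forall>q\<in>W. attached k D R q)"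
proof -
  obtain \<alpha> :: real and d1 where "\<alpha> > 0" and samp: "\<And>(D :: 'a rel) V rank d Q. \<lbrakk>finite V; asym D; clique_free c (D \<union> D\<inverse>) V; d1 \<le> d;
    inj_on rank V; \<forall>v\<in>V. card (forward rank (D \<union> D\<inverse>) V v) \<le> d; Q \<subseteq> V;
    \<forall>q\<in>Q. d \<le> 2 * card (nbrs (D\<inverse>) V q) \<and> card (nbrs (D \<union> D\<inverse>) V q) \<le> 4 * d\<rbrakk> \<Longrightarrow>
    \<exists>R\<subseteq>V. \<exists>Q'\<subseteq>Q. stable_set (D \<union> D\<inverse>) R \<and> (\<forall>q\<in>Q'. attached k D R q) \<and>
       \<alpha> * card Q * (card V + d * card R) \<le> card Q' * card V"
    by (rule sampling[OF k]) (rule that)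
  \<comment> \<open>The 16 combines \<open>card V \<le> 4 * card Q\<close> with the degree bound
    \<open>4 * d\<close>.\<close>
  obtain t :: nat where t: "16 / \<alpha> \<le> t" using real_arch_simple by blast
  obtain a where ind: "\<And>(E :: 'a rel) V \<Delta>. \<lbrakk>sym E; irrefl E; finite V; clique_free c E V;
     \<forall>v\<in>V. card (nbrs E V v) \<le> \<Delta>; a \<le> \<Delta>\<rbrakk> \<Longrightarrow> \<exists>W\<in>stable_sets E V. t * card V \<le> \<Delta> * card W"
    using large_stable_set[of c t] by metis
  have "\<exists>R\<subseteq>V. \<exists>W\<subseteq>V. W \<noteq> {} \<and> card R \<le> card W \<and> stable_set (D \<union> D\<inverse>) R \<and> stable_set (D \<union> D\<inverse>) W \<and>
      (\<forall>q\<in>W. attached k D R q)"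
    if V: "finite V" "V \<noteq> {}" and D: "asym D" and cf: "clique_free c (D \<union> D\<inverse>) V" and d: "d1 + a + 1 \<le> d"
      and rank: "inj_on rank V" and fw: "\<forall>v\<in>V. card (forward rank (D \<union> D\<inverse>) V v) \<le> d"
      and Q: "Q \<subseteq> V" "card V \<le> 4 * card Q"
      and qs: "\<forall>q\<in>Q. d \<le> 2 * card (nbrs (D\<inverse>) V q) \<and> card (nbrs (D \<union> D\<inverse>) V q) \<le> 4 * d"
    for D :: "'a rel" and V rank d Q
  proof -
    define E where "E = D \<union> D\<inverse>"
    have E: "sym E" "irrefl E" using D by (auto simp: E_def sym_def irrefl_def dest: asymD)
    have "d1 \<le> d" using d by simp
    from samp[OF V(1) D cf this rank fw Q(1) qs, folded E_def]
    obtain R Q' where R: "R \<subseteq> V" "stable_set E R" and Q': "Q' \<subseteq> Q" "\<forall>q\<in>Q'. attached k D R q"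
      and ineq: "\<alpha> * card Q * (card V + d * card R) \<le> card Q' * card V"
      by (elim exE conjE) (rule that)
    have Q'V: "Q' \<subseteq> V" using Q'(1) Q(1) by (rule subset_trans)
    have fQ': "finite Q'" using Q'V V(1) by (rule finite_subset)
    have cV: "card V > 0" using V by (simp add: card_gt_0_iff)
    then have cQ: "card Q > 0" using Q(2) by linarith
    have "\<forall>v\<in>Q'. card (nbrs E Q' v) \<le> 4 * d"
    proof
      fix v assume v: "v \<in> Q'"
      have "card (nbrs E Q' v) \<le> card (nbrs E V v)"
        by (rule card_mono) (use V Q'V in \<open>auto simp: nbrs_def\<close>)
      then show "card (nbrs E Q' v) \<le> 4 * d" using qs v Q' by (fastforce simp: E_def)
    qed
    moreover have "clique_free c E Q'" using cf Q'V clique_free_mono by (auto simp: E_def)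
    ultimately obtain W where W: "W \<subseteq> Q'" "stable_set E W" "t * card Q' \<le> 4 * d * card W"
      using ind[OF E fQ', of "4 * d"] d by (auto simp: stable_sets_def)
    have "\<alpha> * card Q * card V \<le> \<alpha> * card Q * (card V + d * card R)"
      using \<open>\<alpha> > 0\<close> by (intro mult_left_mono) auto
    also note ineq
    finally have "\<alpha> * card Q * card V \<le> card Q' * card V" .
    moreover have "\<alpha> * card Q * card V > 0" using \<open>\<alpha> > 0\<close> cQ cV by simp
    ultimately have "card Q' > 0" using not_gr_zero by fastforce
    moreover have "t > 0" using t \<open>\<alpha> > 0\<close> by (intro gr0I) (simp add: divide_le_0_iff)
    ultimately have "4 * d * card W > 0" using W(3) by (intro less_le_trans[OF _ W(3)]) simp
    then have "W \<noteq> {}" by auto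
    have "card R \<le> card W"
    proof -
      have "(card Q * (\<alpha> * d * card R)) = \<alpha> * card Q * (d * card R)" by simp
      also have "\<dots> \<le> \<alpha> * card Q * (card V + d * card R)"
        using \<open>\<alpha> > 0\<close> by (intro mult_left_mono) auto
      also note ineq
      also have "real (card Q' * card V) \<le> card Q * (4 * card Q')"
        using mult_left_mono[OF Q(2), of "card Q'"] by (simp only: of_nat_le_iff mult_ac)
      finally have "\<alpha> * d * card R \<le> 4 * real (card Q')" using cQ by simp
      then have "t * (\<alpha> * d * card R) \<le> t * (4 * real (card Q'))" by (rule mult_left_mono) simp
      also have "\<dots> = 4 * real (t * card Q')" by simp
      also have "\<dots> \<le> 4 * real (4 * d * card W)" using W(3) by (intro mult_left_mono) (simp only: of_nat_le_iff, simp)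
      finally have "(t * \<alpha>) * (d * real (card R)) \<le> 16 * (d * real (card W))" by (simp add: mult_ac)
      moreover have "16 * (d * real (card R)) \<le> (t * \<alpha>) * (d * real (card R))"
        using t \<open>\<alpha> > 0\<close> by (intro mult_right_mono) (auto simp: field_simps)
      ultimately have "d * real (card R) \<le> d * real (card W)" by linarith
      then show ?thesis using d by simp
    qed
    then show ?thesis using R W \<open>W \<noteq> {}\<close> Q' Q'V unfolding E_def by (meson subsetD subset_trans)
  qed
  then show thesis by (rule that)
qed

text \<open>This supplies the set \<open>Q\<close>. The average degree is at most
  \<open>2 * d\<close>, so by Markov's inequality half of the vertices have degree at most
  \<open>4 * d\<close>; each has \<open>d / 2\<close> in-neighbours or \<open>d / 2\<close>
  out-neighbours, and one alternative covers a quarter of \<open>V\<close>.\<close>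

lemma antidirected_pair:
  assumes k: "k > 0"
  obtains d0 where "\<And>(D :: 'a rel) V d. \<lbrakk>finite V; V \<noteq> {}; asym D; clique_free c (D \<union> D\<inverse>) V; d0 \<le> d;
    degenerate d (D \<union> D\<inverse>) V; \<forall>v\<in>V. d \<le> card (nbrs (D \<union> D\<inverse>) V v)\<rbrakk> \<Longrightarrow>
    \<exists>R\<subseteq>V. \<exists>W\<subseteq>V. W \<noteq> {} \<and> card R \<le> card W \<and> stable_set (D \<union> D\<inverse>) R \<and> stable_set (D \<union> D\<inverse>) W \<and>
      ((\<forall>q\<in>W. attached k D R q) \<or> (\<forall>q\<in>W. attached k (D\<inverse>) R q))"
proof -
  obtain d1 where pair: "\<And>(D :: 'a rel) V rank d Q. \<lbrakk>finite V; V \<noteq> {}; asym D; clique_free c (D \<union> D\<inverse>) V; d1 \<le> d;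
    inj_on rank V; \<forall>v\<in>V. card (forward rank (D \<union> D\<inverse>) V v) \<le> d; Q \<subseteq> V; card V \<le> 4 * card Q;
    \<forall>q\<in>Q. d \<le> 2 * card (nbrs (D\<inverse>) V q) \<and> card (nbrs (D \<union> D\<inverse>) V q) \<le> 4 * d\<rbrakk> \<Longrightarrow>
    \<exists>R\<subseteq>V. \<exists>W\<subseteq>V. W \<noteq> {} \<and> card R \<le> card W \<and> stable_set (D \<union> D\<inverse>) R \<and> stable_set (D \<union> D\<inverse>) W \<and>
      (\<forall>q\<in>W. attached k D R q)"
    by (rule attached_pair[OF k]) (rule that)
  have "\<exists>R\<subseteq>V. \<exists>W\<subseteq>V. W \<noteq> {} \<and> card R \<le> card W \<and> stable_set (D \<union> D\<inverse>) R \<and> stable_set (D \<union> D\<inverse>) W \<and>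
      ((\<forall>q\<in>W. attached k D R q) \<or> (\<forall>q\<in>W. attached k (D\<inverse>) R q))"
    if V: "finite V" "V \<noteq> {}" and D: "asym D" and cf: "clique_free c (D \<union> D\<inverse>) V" and d: "Suc d1 \<le> d"
      and dg: "degenerate d (D \<union> D\<inverse>) V" and deg: "\<forall>v\<in>V. d \<le> card (nbrs (D \<union> D\<inverse>) V v)"
    for D :: "'a rel" and V d
  proof -
    define E where "E = D \<union> D\<inverse>"
    have E: "sym E" "irrefl E" using D by (auto simp: E_def sym_def irrefl_def dest: asymD)
    obtain rank where rank: "inj_on rank V" and fw: "\<forall>v\<in>V. card (forward rank E V v) \<le> d"
      using degenerate_rank[OF V(1)] dg unfolding E_def by metis
    define M where "M = {v \<in> V. card (nbrs E V v) \<le> 4 * d}"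
    define M1 where "M1 = {v \<in> M. d \<le> 2 * card (nbrs (D\<inverse>) V v)}"
    define M2 where "M2 = {v \<in> M. d \<le> 2 * card (nbrs D V v)}"
    have M: "M \<subseteq> V" "finite M" using V by (auto simp: M_def)
    have "4 * d * card (V - M) = (\<Sum>v\<in>V - M. 4 * d)" by simp
    also have "\<dots> \<le> (\<Sum>v\<in>V - M. card (nbrs E V v))" by (rule sum_mono) (auto simp: M_def)
    also have "\<dots> \<le> (\<Sum>v\<in>V. card (nbrs E V v))" by (rule sum_mono2) (use V in auto)
    also have "\<dots> \<le> 2 * d * card V" by (rule degree_sum_le[OF V(1) E rank]) (use fw in blast)
    finally have "2 * d * (2 * card (V - M)) \<le> 2 * d * card V" by simp
    then have "2 * card (V - M) \<le> card V" using d by simp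
    moreover have "card (V - M) = card V - card M" "card M \<le> card V"
      using M V by (auto simp: card_Diff_subset card_mono)
    ultimately have half: "card V \<le> 2 * card M" by linarith
    have "M \<subseteq> M1 \<union> M2"
    proof
      fix v assume v: "v \<in> M"
      have "nbrs E V v = nbrs (D\<inverse>) V v \<union> nbrs D V v" by (auto simp: nbrs_def E_def)
      then have "card (nbrs E V v) \<le> card (nbrs (D\<inverse>) V v) + card (nbrs D V v)"
        by (metis card_Un_le)
      then have "d \<le> card (nbrs (D\<inverse>) V v) + card (nbrs D V v)"
        using deg v M by (fastforce simp: E_def)
      then show "v \<in> M1 \<union> M2" using v unfolding M1_def M2_def by auto
    qed
    then have "card M \<le> card (M1 \<union> M2)"
      by (rule card_mono[rotated]) (use M in \<open>auto simp: M1_def M2_def\<close>)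
    also have "\<dots> \<le> card M1 + card M2" by (rule card_Un_le)
    finally have "card V \<le> 4 * card M1 \<or> card V \<le> 4 * card M2" using half by linarith
    then show ?thesis
    proof
      assume c1: "card V \<le> 4 * card M1"
      have "\<exists>R\<subseteq>V. \<exists>W\<subseteq>V. W \<noteq> {} \<and> card R \<le> card W \<and> stable_set (D \<union> D\<inverse>) R \<and> stable_set (D \<union> D\<inverse>) W \<and>
        (\<forall>q\<in>W. attached k D R q)"
        by (rule pair[OF V D cf _ rank _ _ c1]) (use d fw in \<open>auto simp: E_def M_def M1_def\<close>)
      then show ?thesis by metis
    next
      assume c2: "card V \<le> 4 * card M2"
      \<comment> \<open>Reversing all arcs leaves the underlying graph unchanged and exchanges the
        two alternatives.\<close>
      have D': "asym (D\<inverse>)" using D by (auto intro!: asymI dest: asymD)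
      have E': "D\<inverse> \<union> (D\<inverse>)\<inverse> = E" by (auto simp: E_def)
      have "\<exists>R\<subseteq>V. \<exists>W\<subseteq>V. W \<noteq> {} \<and> card R \<le> card W \<and> stable_set E R \<and> stable_set E W \<and>
        (\<forall>q\<in>W. attached k (D\<inverse>) R q)"
        by (rule pair[OF V D', unfolded E', OF _ _ rank _ _ c2])
          (use d fw cf in \<open>auto simp: E_def M_def M2_def\<close>)
      then show ?thesis unfolding E_def by metis
    qed
  qed
  then show thesis by (rule that)
qed

subsection \<open>Degeneracy, bicliques and orientations\<close>

definition induced :: "'a pair_pre_digraph \<Rightarrow> 'a set \<Rightarrow> 'a pair_pre_digraph" where
  "induced G S = \<lparr>pverts = S, parcs = parcs G \<inter> S \<times> S\<rparr>"

lemma induced_simps [simp]: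
  "pverts (induced G S) = S" "parcs (induced G S) = parcs G \<inter> S \<times> S"
  by (simp_all add: induced_def)

lemma pair_subgraph_iff:
  "subgraph (with_proj H) (with_proj G) \<longleftrightarrow>
     pverts H \<subseteq> pverts G \<and> parcs H \<subseteq> parcs G \<and> pair_wf_digraph G \<and> pair_wf_digraph H"
  by (auto simp: subgraph_def wf_digraph_wp_iff compatible_def)

lemma pair_graph_sym_irrefl:
  assumes "pair_graph G"
  shows "sym (parcs G)" "irrefl (parcs G)" "finite (pverts G)" "parcs G \<subseteq> pverts G \<times> pverts G"
proof -
  interpret pair_graph G by fact
  show "sym (parcs G)" using pair_sym_arcs by (simp add: symmetric_def)
  show "irrefl (parcs G)" using pair_no_loops by (fastforce simp: irrefl_def)
  show "finite (pverts G)" by (rule pair_finite_verts)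
  show "parcs G \<subseteq> pverts G \<times> pverts G" using wellformed' by auto
qed

lemma pair_graphI:
  assumes "sym (parcs G)" "irrefl (parcs G)" "finite (pverts G)" "parcs G \<subseteq> pverts G \<times> pverts G"
  shows "pair_graph G"
proof
  show "symmetric (with_proj G)" using assms(1) by (simp add: symmetric_def)
  show "finite (parcs G)" using assms(3,4) by (meson finite_SigmaI finite_subset)
qed (use assms in \<open>auto simp: irrefl_def\<close>)

lemma pair_graph_induced:
  assumes "pair_graph G" "S \<subseteq> pverts G"
  shows "pair_graph (induced G S)" "subgraph (with_proj (induced G S)) (with_proj G)"
proof -
  note G = pair_graph_sym_irrefl[OF assms(1)]
  show H: "pair_graph (induced G S)"
    by (rule pair_graphI)
      (use G assms(2) finite_subset in \<open>auto simp: sym_def irrefl_def\<close>)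
  show "subgraph (with_proj (induced G S)) (with_proj G)"
    using assms H unfolding pair_subgraph_iff
    by (auto intro: pair_graph.axioms pair_digraph.axioms pair_fin_digraph.axioms)
qed

lemma out_degree_eq_card_nbrs:
  assumes "pair_wf_digraph H"
  shows "out_degree (with_proj H) v = card (nbrs (parcs H) (pverts H) v)"
proof -
  interpret pair_wf_digraph H by fact
  have "out_arcs (with_proj H) v = Pair v ` nbrs (parcs H) (pverts H) v"
    using wellformed' by (auto simp: nbrs_def out_arcs_def)
  then show ?thesis by (simp add: out_degree_def card_image inj_on_def)
qed

lemma degenerate_degeneracy:
  assumes "pair_graph G"
  shows "degenerate (degeneracy G) (parcs G) (pverts G)"
  unfolding degenerate_def
proof (intro allI impI)
  fix S assume S: "S \<subseteq> pverts G" "S \<noteq> {}"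
  note H = pair_graph_induced[OF assms S(1)]
  have wf: "pair_wf_digraph (induced G S)" using H(2) by (simp add: pair_subgraph_iff)
  have "\<exists>v\<in>pverts (induced G S). out_degree (with_proj (induced G S)) v \<le> degeneracy G"
    unfolding degeneracy_def
    using LeastI_ex[OF degeneracy_exists[OF assms]] H S by auto
  then obtain v where v: "v \<in> S" "card (nbrs (parcs (induced G S)) S v) \<le> degeneracy G"
    using out_degree_eq_card_nbrs[OF wf] by auto
  moreover have "nbrs (parcs (induced G S)) S v = nbrs (parcs G) S v"
    using v by (auto simp: nbrs_def)
  ultimately show "\<exists>v\<in>S. card (nbrs (parcs G) S v) \<le> degeneracy G" by auto
qed

text \<open>By minimality, \<open>degeneracy G - 1\<close> fails for some subgraph. Keeping its
  vertices and restoring all edges of \<open>G\<close> between them only raises degrees.\<close>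

lemma min_degree_subgraph:
  assumes "pair_graph G" "degeneracy G > 0"
  obtains V where "V \<subseteq> pverts G" "V \<noteq> {}" "\<forall>v\<in>V. degeneracy G \<le> card (nbrs (parcs G) V v)"
proof -
  have "degeneracy G - 1 < degeneracy G" using assms by simp
  then obtain H where H: "pair_graph H" "subgraph (with_proj H) (with_proj G)" "pverts H \<noteq> {}"
    and deg: "\<forall>v\<in>pverts H. \<not> out_degree (with_proj H) v \<le> degeneracy G - 1"
    unfolding degeneracy_def by (blast dest: not_less_Least)
  have HG: "pverts H \<subseteq> pverts G" "parcs H \<subseteq> parcs G" "pair_wf_digraph H"
    using H(2) by (auto simp: pair_subgraph_iff)
  have "degeneracy G \<le> card (nbrs (parcs G) (pverts H) v)" if v: "v \<in> pverts H" for v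
  proof -
    have "degeneracy G \<le> card (nbrs (parcs H) (pverts H) v)"
      using deg v out_degree_eq_card_nbrs[OF HG(3)] by auto
    also have "\<dots> \<le> card (nbrs (parcs G) (pverts H) v)"
      by (rule card_mono) (use HG pair_graph_sym_irrefl(3)[OF H(1)] in \<open>auto simp: nbrs_def\<close>)
    finally show ?thesis .
  qed
  then show thesis using that HG(1) H(3) by blast
qed

text \<open>Splitting a clique on \<open>2 * s\<close> vertices into two halves exhibits a biclique,
  since bicliques need not be induced.\<close>

lemma clique_free_if_no_biclique:
  assumes G: "pair_graph G" and "\<not> contains_biclique s G"
  shows "clique_free (2 * s) (parcs G) (pverts G)"
  unfolding clique_free_def
proof
  assume "\<exists>K\<subseteq>pverts G. card K = 2 * s \<and> (\<forall>u\<in>K. \<forall>v\<in>K. u \<noteq> v \<longrightarrow> (u, v) \<in> parcs G)"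
  then obtain K where K: "K \<subseteq> pverts G" "card K = 2 * s"
    "\<And>u v. u \<in> K \<Longrightarrow> v \<in> K \<Longrightarrow> u \<noteq> v \<Longrightarrow> (u, v) \<in> parcs G" by blast
  have fK: "finite K" using K(1) pair_graph_sym_irrefl(3)[OF G] finite_subset by blast
  obtain A where A: "A \<subseteq> K" "card A = s"
    using obtain_subset_with_card_n[of s K] K(2) by auto
  let ?B = "K - A"
  let ?H = "\<lparr>pverts = K, parcs = A \<times> ?B \<union> ?B \<times> A\<rparr>"
  have "card ?B = s" using A K(2) fK by (simp add: card_Diff_subset finite_subset)
  then have "K\<^bsub>s,s\<^esub> (with_proj ?H)"
    unfolding complete_bipartite_digraph_pair_def
    using A fK by (intro conjI exI[of _ A] exI[of _ ?B]) auto
  moreover have "pair_wf_digraph ?H" using A by unfold_locales auto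
  then have "subgraph (with_proj ?H) (with_proj G)"
    using K(1,3) A(1) G unfolding pair_subgraph_iff
    by (auto intro: pair_graph.axioms pair_digraph.axioms pair_fin_digraph.axioms)
  ultimately show False using assms(2) unfolding contains_biclique_def by blast
qed

lemma not_contains_biclique:
  assumes "pair_graph G" "biclique_number G < s"
  shows "\<not> contains_biclique s G"
proof
  assume "contains_biclique s G"
  then have "s \<le> biclique_number G"
    unfolding biclique_number_def by (intro Max_ge finite_bicliques[OF assms(1)]) simp
  then show False using assms(2) by simp
qed

lemma biclique_number_mono:
  assumes "pair_graph G" "pair_graph H" "subgraph (with_proj H) (with_proj G)"
  shows "biclique_number H \<le> biclique_number G"
  unfolding biclique_number_def
proof (rule Max_mono)
  show "{s. contains_biclique s H} \<subseteq> {s. contains_biclique s G}"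
    using assms(3) subgraph_trans unfolding contains_biclique_def by blast
  show "{s. contains_biclique s H} \<noteq> {}" using contains_biclique_0[OF assms(2)] by blast
qed (rule finite_bicliques[OF assms(1)])

section \<open>Antidirected induced subdigraphs\<close>

lemma parcs_underlying:
  "parcs (underlying_graph D) = parcs D \<union> (parcs D)\<inverse>"
  by (auto simp: parcs_mk_symmetric)

lemma underlying_induced:
  "underlying_graph (induced D S) = induced (underlying_graph D) S"
  by (auto simp: parcs_mk_symmetric induced_def mk_symmetric_def)

text \<open>Stability leaves only arcs between \<open>R\<close> and \<open>W\<close>, and
  \<open>att\<close> forces all of them to run in the same direction.\<close>

lemma antidirected_induced:
  assumes D: "oriented_graph D" and RW: "R \<subseteq> pverts D" "W \<subseteq> pverts D"
    and st: "stable_set (parcs D) R" "stable_set (parcs D) W"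
    and att: "(\<forall>q\<in>W. nbrs (parcs D) R q = {}) \<or> (\<forall>q\<in>W. nbrs ((parcs D)\<inverse>) R q = {})"
  shows "antidirected (induced D (R \<union> W))"
    and "induced_subgraph (with_proj (induced D (R \<union> W))) (with_proj D)"
proof -
  let ?H = "induced D (R \<union> W)"
  interpret pair_digraph D using D by (simp add: oriented_graph_def)
  have "finite (R \<union> W)" using RW pair_finite_verts finite_subset by blast
  then have H: "pair_digraph ?H"
    by unfold_locales
      (use pair_finite_arcs pair_no_loops in auto)
  then have "subgraph (with_proj ?H) (with_proj D)"
    using RW unfolding pair_subgraph_iff
    by (auto intro: pair_wf_digraph_axioms pair_digraph.axioms pair_fin_digraph.axioms)
  then show "induced_subgraph (with_proj ?H) (with_proj D)"
    by (auto simp: induced_subgraph_def)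
  have "source ?H v \<or> sink ?H v" if v: "v \<in> R \<union> W" for v
    using att
  proof
    assume "\<forall>q\<in>W. nbrs (parcs D) R q = {}"
    then have "parcs ?H \<subseteq> R \<times> W"
      using st by (auto simp: nbrs_def stable_set_def)
    then show ?thesis
      using v st by (auto simp: source_def sink_def in_arcs_def out_arcs_def stable_set_def)
  next
    assume "\<forall>q\<in>W. nbrs ((parcs D)\<inverse>) R q = {}"
    then have "parcs ?H \<subseteq> W \<times> R"
      using st by (auto simp: nbrs_def stable_set_def)
    then show ?thesis
      using v st by (auto simp: source_def sink_def in_arcs_def out_arcs_def stable_set_def)
  qed
  then show "antidirected ?H"
    using H D by (auto simp: antidirected_def oriented_graph_def)
qed

text \<open>If the degeneracy of \<open>G\<close> were too large, the orientation would contain an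
  antidirected induced subdigraph whose underlying graph lies in \<open>\<G>\<close> but has too
  many edges for the degeneracy that \<open>g\<close> allows.\<close>

lemma degeneracy_bound:
  fixes \<G> :: "'a pair_pre_digraph set"
  assumes g: "\<And>H. H \<in> \<G> \<Longrightarrow> degeneracy H \<le> g (biclique_number H)"
  shows "\<exists>b. \<forall>G\<in>antidirected_extension \<G>. biclique_number G = s \<longrightarrow> degeneracy G \<le> b"
proof -
  \<comment> \<open>The subgraph found later may have a smaller biclique number than
    \<open>G\<close>, and \<open>g\<close> need not be monotone, so the maximum over all values up
    to \<open>s\<close> is taken.\<close>
  define K where "K = Max (g ` {..s})"
  have K: "g i \<le> K" if "i \<le> s" for i unfolding K_def using that by simp
  \<comment> \<open>With \<open>card S \<le> 2 * card W\<close> the degree sum of \<open>U\<close>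
    is at most \<open>4 * K * card W\<close>; one more neighbour per vertex of \<open>W\<close>
    gives the contradiction.\<close>
  define k where "k = 4 * K + 1"
  have "k > 0" by (simp add: k_def)
  then obtain d0 where pair: "\<And>(D :: 'a rel) V d. \<lbrakk>finite V; V \<noteq> {}; asym D; clique_free (2 * (s + 1)) (D \<union> D\<inverse>) V; d0 \<le> d;
    degenerate d (D \<union> D\<inverse>) V; \<forall>v\<in>V. d \<le> card (nbrs (D \<union> D\<inverse>) V v)\<rbrakk> \<Longrightarrow>
    \<exists>R\<subseteq>V. \<exists>W\<subseteq>V. W \<noteq> {} \<and> card R \<le> card W \<and> stable_set (D \<union> D\<inverse>) R \<and> stable_set (D \<union> D\<inverse>) W \<and>
      ((\<forall>q\<in>W. attached k D R q) \<or> (\<forall>q\<in>W. attached k (D\<inverse>) R q))"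
    by (rule antidirected_pair) (rule that)
  have "degeneracy G \<le> d0" if G: "G \<in> antidirected_extension \<G>" and s: "biclique_number G = s" for G
  proof (rule ccontr)
    let ?d = "degeneracy G"
    assume "\<not> ?d \<le> d0"
    then have d: "d0 \<le> ?d" "?d > 0" by auto
    have pg: "pair_graph G" and "orientable \<G> G"
      using G by (auto simp: antidirected_extension_def)
    then obtain D where or: "oriented_graph D" and UD: "underlying_graph D = G"
      and anti: "\<And>H. induced_subgraph (with_proj H) (with_proj D) \<Longrightarrow> antidirected H \<Longrightarrow> underlying_graph H \<in> \<G>"
      unfolding orientable_def orientation_of_def by blast
    define A where "A = parcs D"
    have EG: "A \<union> A\<inverse> = parcs G" using UD parcs_underlying[of D] by (simp add: A_def)
    have VG: "pverts D = pverts G" using UD by auto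
    have asym: "asym A" using or by (auto simp: A_def oriented_graph_def intro: asymI)
    note pg' = pair_graph_sym_irrefl[OF pg]
    obtain V where V: "V \<subseteq> pverts G" "V \<noteq> {}" "\<forall>v\<in>V. ?d \<le> card (nbrs (parcs G) V v)"
      by (rule min_degree_subgraph[OF pg d(2)])
    have cf: "clique_free (2 * (s + 1)) (parcs G) V"
      using clique_free_mono[OF clique_free_if_no_biclique[OF pg not_contains_biclique[OF pg]] V(1), of "s + 1"] s
      by simp
    have dg: "degenerate ?d (parcs G) V"
      using degenerate_mono[OF degenerate_degeneracy[OF pg] V(1)] .
    have fV: "finite V" using V(1) pg'(3) finite_subset by blast
    obtain R W where RW: "R \<subseteq> V" "W \<subseteq> V" "W \<noteq> {}" "card R \<le> card W"
      and st: "stable_set (parcs G) R" "stable_set (parcs G) W"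
      and att: "(\<forall>q\<in>W. attached k A R q) \<or> (\<forall>q\<in>W. attached k (A\<inverse>) R q)"
      using pair[OF fV V(2) asym, unfolded EG, OF cf d(1) dg V(3)] by metis
    define S where "S = R \<union> W"
    have SG: "S \<subseteq> pverts G" using RW V(1) by (auto simp: S_def)
    define U where "U = induced G S"
    note U = pair_graph_induced[OF pg SG, folded U_def]
    have fin: "finite R" "finite W" "finite S" using RW fV finite_subset by (auto simp: S_def)
    have DR: "stable_set (parcs D) R" "stable_set (parcs D) W"
      using st unfolding EG[symmetric] by (auto simp: stable_set_def A_def)
    have "(\<forall>q\<in>W. nbrs (parcs D) R q = {}) \<or> (\<forall>q\<in>W. nbrs ((parcs D)\<inverse>) R q = {})"
      using att by (auto simp: attached_def A_def)
    from antidirected_induced[OF or _ _ DR this] have "underlying_graph (induced D S) \<in> \<G>"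
      using anti RW V(1) VG by (auto simp: S_def)
    then have "U \<in> \<G>" by (simp add: underlying_induced UD U_def)
    then have "degeneracy U \<le> g (biclique_number U)" by (rule g)
    also have "\<dots> \<le> K" using K biclique_number_mono[OF pg U] s by simp
    finally have dU: "degeneracy U \<le> K" .
    have US: "pverts U = S" by (simp add: U_def)
    note U' = pair_graph_sym_irrefl[OF U(1)]
    obtain rank where rank: "inj_on rank S" "\<And>v. v \<in> S \<Longrightarrow> card (forward rank (parcs U) S v) \<le> degeneracy U"
      using degenerate_rank[OF fin(3)] degenerate_degeneracy[OF U(1)] US by metis
    have "k * card W = (\<Sum>q\<in>W. k)" by simp
    also have "\<dots> \<le> (\<Sum>q\<in>W. card (nbrs (parcs U) S q))"
    proof (rule sum_mono)
      fix q assume q: "q \<in> W"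
      have sub: "nbrs (A\<inverse>) R q \<subseteq> nbrs (parcs U) S q" "nbrs A R q \<subseteq> nbrs (parcs U) S q"
        using q by (auto simp: nbrs_def U_def S_def EG[symmetric])
      have "k \<le> card (nbrs (A\<inverse>) R q) \<or> k \<le> card (nbrs A R q)"
        using att q by (auto simp: attached_def)
      then show "k \<le> card (nbrs (parcs U) S q)"
        using card_mono[OF finite_nbrs[OF fin(3)] sub(1)] card_mono[OF finite_nbrs[OF fin(3)] sub(2)] by linarith
    qed
    also have "\<dots> \<le> (\<Sum>q\<in>S. card (nbrs (parcs U) S q))"
      by (rule sum_mono2) (use fin in \<open>auto simp: S_def\<close>)
    also have "\<dots> \<le> 2 * degeneracy U * card S"
      by (rule degree_sum_le[OF fin(3) U'(1,2) rank])
    also have "\<dots> \<le> 2 * K * (2 * card W)"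
    proof (rule mult_le_mono)
      show "2 * degeneracy U \<le> 2 * K" using dU by simp
      show "card S \<le> 2 * card W" using card_Un_le[of R W] RW(4) by (simp add: S_def)
    qed
    finally have "card W = 0" by (simp add: k_def)
    then show False using fin(2) RW(3) by simp
  qed
  then show ?thesis by blast
qed

theorem corollary1p4:
  fixes \<G> :: "'a pair_pre_digraph set"
  assumes "graph_class \<G>"
    and "hereditary \<G>"
    and "degree_bounded \<G>"
  shows "degree_bounded (antidirected_extension \<G>)"
proof -
  obtain g where "\<And>H. H \<in> \<G> \<Longrightarrow> degeneracy H \<le> g (biclique_number H)"
    using assms(3) unfolding degree_bounded_def by blast
  then have "\<forall>s. \<exists>b. \<forall>G\<in>antidirected_extension \<G>. biclique_number G = s \<longrightarrow> degeneracy G \<le> b"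
    by (intro allI degeneracy_bound)
  \<comment> \<open>Choosing a bound for each biclique number yields the required function.\<close>
  then obtain b where "\<And>G s. G \<in> antidirected_extension \<G> \<Longrightarrow> biclique_number G = s \<Longrightarrow> degeneracy G \<le> b s"
    by metis
  then show ?thesis unfolding degree_bounded_def by blast
qed

end
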